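(* Let $(Z,z_0)$ and $(X,x_0)$ be pointed types with $X$ connected. The map that forgets pointedness induces an equivalence between the orbit set $\|(Z,z_0)\to_*(X,x_0)\|_0 \,/\, \pi_1(X,x_0)$ and $\|Z\to X\|_0$.
   Context: We work in homotopy type theory (Martin-Löf type theory with a univalent universe $\mathsf{Type}$, function extensionality and higher inductive types). $\|A\|$ is propositional truncation, $\|A\|_0$ is set truncation with constructor $|\cdot|_0$; $\pi_1(X,x_0):=\|x_0=_X x_0\|_0$. A type $X$ is connected if $\|x =_X y\|$ is inhabited for all $x,y:X$. For a type family $P : X\to\mathsf{Type}$, $p : a =_X b$ and $u:P(a)$, $\mathsf{transport}^P(p,u) : P(b)$ is transport. The type of pointed maps is $((Z,z_0)\to_*(X,x)) := \sum_{f:Z\to X} (f(z_0)=_X x)$; the map that forgets pointedness is the first projection $(f,w_f)\mapsto f$, and the induced map on the orbit set sends the class of $|(f,w_f)|_0$ to $|f|_0$. The (right) action of $\pi_1(X,x_0)$ on the set $\|(Z,z_0)\to_*(X,x_0)\|_0$ is defined on truncated loops $|p|_0:\pi_1(X,x_0)$ by $g\,.\,|p|_0 := \mathsf{transport}^{\|(Z,z_0)\to_*(X,-)\|_0}(p,g)$. The orbit set is the set-quotient by the relation that $g_1,g_2$ lie in the same orbit, i.e. that there merely exists $p:\pi_1(X,x_0)$ with $g_1\,.\,p = g_2$. *)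

theory Defs
  imports Main
begin

text \<open>
  Homotopy type theory is deeply embedded: raw terms, convertibility and typing follow the
  first formal presentation in the appendix of the HoTT book (unannotated abstractions,
  convertibility of raw terms, a cumulative hierarchy of Russell universes, and primitive
  constants for all type formers other than the dependent product), with the eta rule for
  functions.  A theorem of homotopy type theory is a type with a closed term.
\<close>

section \<open>Raw terms\<close>

datatype const =
    CUnit | CStar | CUnitInd
  | CEmpty | CEmptyInd
  | CSum | CInl | CInr | CSumInd
  | CNat | CZero | CSucc | CNatInd
  | CW | CSup | CWInd
  | CSigma | CPair | CSigmaInd
  | CId | CRefl | CIdInd
  | CFunext | CUnivalence
  | CPTrunc | CPTr | CPTrEq | CPTrInd
  | CSTrunc | CSTr | CSTrSet | CSTrInd
  | CQuot | CCls | CClsEq | CQuotSet | CQuotInd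

text \<open>Variables are de Bruijn indices.\<close>

datatype trm = Var nat | U nat | Pi trm trm | Lam trm | App trm trm | Const const

primrec lift :: "nat \<Rightarrow> trm \<Rightarrow> trm" where
  "lift k (Var n) = (if n < k then Var n else Var (Suc n))"
| "lift k (U i) = U i"
| "lift k (Pi A B) = Pi (lift k A) (lift (Suc k) B)"
| "lift k (Lam b) = Lam (lift (Suc k) b)"
| "lift k (App f a) = App (lift k f) (lift k a)"
| "lift k (Const c) = Const c"

primrec subst :: "nat \<Rightarrow> trm \<Rightarrow> trm \<Rightarrow> trm" where
  "subst k u (Var n) = (if n < k then Var n else if n = k then u else Var (n - 1))"
| "subst k u (U i) = U i"
| "subst k u (Pi A B) = Pi (subst k u A) (subst (Suc k) (lift 0 u) B)"
| "subst k u (Lam b) = Lam (subst (Suc k) (lift 0 u) b)"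
| "subst k u (App f a) = App (subst k u f) (subst k u a)"
| "subst k u (Const c) = Const c"

definition capp :: "const \<Rightarrow> trm list \<Rightarrow> trm" where
  "capp c ts = foldl App (Const c) ts"

section \<open>Named binders for concrete terms\<close>

text \<open>
  An expression maps the number of enclosing binders to a raw term.  A variable introduced below
  \<open>n\<close> binders has, below \<open>m > n\<close> binders, the de Bruijn index \<open>m - Suc n\<close>.  This only serves to
  write down concrete closed terms with named variables.
\<close>

type_synonym expr = "nat \<Rightarrow> trm"

definition bind :: "(expr \<Rightarrow> expr) \<Rightarrow> expr" where
  "bind f = (\<lambda>n. f (\<lambda>m. Var (m - Suc n)) (Suc n))"

definition lam :: "(expr \<Rightarrow> expr) \<Rightarrow> expr"  (binder "\<^bold>\<lambda>" 10) where
  "lam f = (\<lambda>n. Lam (bind f n))"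

definition pi :: "expr \<Rightarrow> (expr \<Rightarrow> expr) \<Rightarrow> expr" where
  "pi A B = (\<lambda>n. Pi (A n) (bind B n))"

definition app :: "expr \<Rightarrow> expr \<Rightarrow> expr"  (infixl "\<cdot>" 90) where
  "f \<cdot> a = (\<lambda>n. App (f n) (a n))"

definition univ :: "nat \<Rightarrow> expr" where
  "univ i = (\<lambda>n. U i)"

definition cst :: "const \<Rightarrow> expr list \<Rightarrow> expr" where
  "cst c es = (\<lambda>n. capp c (map (\<lambda>e. e n) es))"

definition closed :: "expr \<Rightarrow> trm" where
  "closed e = e 0"

definition sigma :: "expr \<Rightarrow> (expr \<Rightarrow> expr) \<Rightarrow> expr" where
  "sigma A B = cst CSigma [A, lam B]"

syntax
  "_hott_pi" :: "pttrn \<Rightarrow> expr \<Rightarrow> expr \<Rightarrow> expr"  ("(3\<^bold>\<Pi>_ : _./ _)" [0, 51, 10] 10)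
  "_hott_sigma" :: "pttrn \<Rightarrow> expr \<Rightarrow> expr \<Rightarrow> expr"  ("(3\<^bold>\<Sigma>_ : _./ _)" [0, 51, 10] 10)
translations
  "\<^bold>\<Pi>x : A. B" \<rightleftharpoons> "CONST pi A (\<lambda>x. B)"
  "\<^bold>\<Sigma>x : A. B" \<rightleftharpoons> "CONST sigma A (\<lambda>x. B)"

definition arrow :: "expr \<Rightarrow> expr \<Rightarrow> expr"  (infixr "\<^bold>\<rightarrow>" 60) where
  "A \<^bold>\<rightarrow> B = pi A (\<lambda>_. B)"

definition times :: "expr \<Rightarrow> expr \<Rightarrow> expr"  (infixr "\<^bold>\<times>" 65) where
  "A \<^bold>\<times> B = sigma A (\<lambda>_. B)"

section \<open>Basic notions of homotopy type theory\<close>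

definition pair :: "expr \<Rightarrow> (expr \<Rightarrow> expr) \<Rightarrow> expr \<Rightarrow> expr \<Rightarrow> expr" where
  "pair A B a b = cst CPair [A, lam B, a, b]"

definition pr1 :: "expr \<Rightarrow> (expr \<Rightarrow> expr) \<Rightarrow> expr \<Rightarrow> expr" where
  "pr1 A B p = cst CSigmaInd [A, lam B, \<^bold>\<lambda>_. A, \<^bold>\<lambda>a. \<^bold>\<lambda>b. a, p]"

definition eq :: "expr \<Rightarrow> expr \<Rightarrow> expr \<Rightarrow> expr" where
  "eq A x y = cst CId [A, x, y]"

definition rfl :: "expr \<Rightarrow> expr \<Rightarrow> expr" where
  "rfl A x = cst CRefl [A, x]"

text \<open>\<open>transport A P x y p : P x \<rightarrow> P y\<close>, by path induction.\<close>

definition transport :: "expr \<Rightarrow> expr \<Rightarrow> expr \<Rightarrow> expr \<Rightarrow> expr \<Rightarrow> expr" where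
  "transport A P x y p =
     cst CIdInd [A, \<^bold>\<lambda>x. \<^bold>\<lambda>y. \<^bold>\<lambda>p. P \<cdot> x \<^bold>\<rightarrow> P \<cdot> y, \<^bold>\<lambda>x. \<^bold>\<lambda>u. u, x, y, p]"

definition isProp :: "expr \<Rightarrow> expr" where
  "isProp A = (\<^bold>\<Pi>x : A. \<^bold>\<Pi>y : A. eq A x y)"

definition isSet :: "expr \<Rightarrow> expr" where
  "isSet A = (\<^bold>\<Pi>x : A. \<^bold>\<Pi>y : A. isProp (eq A x y))"

text \<open>Equivalences are the bi-invertible maps.\<close>

definition rinv :: "expr \<Rightarrow> expr \<Rightarrow> expr \<Rightarrow> expr" where
  "rinv A B f = (\<^bold>\<Sigma>g : B \<^bold>\<rightarrow> A. \<^bold>\<Pi>b : B. eq B (f \<cdot> (g \<cdot> b)) b)"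

definition linv :: "expr \<Rightarrow> expr \<Rightarrow> expr \<Rightarrow> expr" where
  "linv A B f = (\<^bold>\<Sigma>h : B \<^bold>\<rightarrow> A. \<^bold>\<Pi>a : A. eq A (h \<cdot> (f \<cdot> a)) a)"

definition isEquiv :: "expr \<Rightarrow> expr \<Rightarrow> expr \<Rightarrow> expr" where
  "isEquiv A B f = rinv A B f \<^bold>\<times> linv A B f"

definition Equiv :: "expr \<Rightarrow> expr \<Rightarrow> expr" where
  "Equiv A B = (\<^bold>\<Sigma>f : A \<^bold>\<rightarrow> B. isEquiv A B f)"

definition idEquiv :: "expr \<Rightarrow> expr" where
  "idEquiv A = (let i = \<^bold>\<lambda>x. x; r = \<^bold>\<lambda>x. rfl A x in
     pair (A \<^bold>\<rightarrow> A) (\<lambda>f. isEquiv A A f) i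
       (pair (rinv A A i) (\<lambda>_. linv A A i)
         (pair (A \<^bold>\<rightarrow> A) (\<lambda>g. \<^bold>\<Pi>b : A. eq A (i \<cdot> (g \<cdot> b)) b) i r)
         (pair (A \<^bold>\<rightarrow> A) (\<lambda>h. \<^bold>\<Pi>a : A. eq A (h \<cdot> (i \<cdot> a)) a) i r)))"

definition idtoeqv :: "nat \<Rightarrow> expr \<Rightarrow> expr \<Rightarrow> expr" where
  "idtoeqv i A B =
     (\<^bold>\<lambda>p. cst CIdInd [univ i, \<^bold>\<lambda>X. \<^bold>\<lambda>Y. \<^bold>\<lambda>p. Equiv X Y, \<^bold>\<lambda>X. idEquiv X, A, B, p])"

definition happly :: "expr \<Rightarrow> expr \<Rightarrow> expr \<Rightarrow> expr \<Rightarrow> expr" where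
  "happly A B f g =
     (\<^bold>\<lambda>p. cst CIdInd [\<^bold>\<Pi>x : A. B \<cdot> x,
                    \<^bold>\<lambda>f. \<^bold>\<lambda>g. \<^bold>\<lambda>p. \<^bold>\<Pi>x : A. eq (B \<cdot> x) (f \<cdot> x) (g \<cdot> x),
                    \<^bold>\<lambda>f. \<^bold>\<lambda>x. rfl (B \<cdot> x) (f \<cdot> x), f, g, p])"

section \<open>Types of the constants\<close>

text \<open>
  Constants carry no universe levels: every constant has the type below for all levels \<open>i\<close> and
  \<open>j\<close>, where \<open>j\<close> is the level of the motive of an eliminator.  The eliminators of the propositional
  and set truncations and of the set quotient require the motive to be a family of propositions
  or sets; this takes the place of the case for the truncation constructor.
\<close>

fun ctype :: "const \<Rightarrow> nat \<Rightarrow> nat \<Rightarrow> expr" where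
  "ctype CUnit i j = univ i"
| "ctype CStar i j = cst CUnit []"
| "ctype CUnitInd i j =
     (\<^bold>\<Pi>C : cst CUnit [] \<^bold>\<rightarrow> univ j. C \<cdot> cst CStar [] \<^bold>\<rightarrow> (\<^bold>\<Pi>x : cst CUnit []. C \<cdot> x))"
| "ctype CEmpty i j = univ i"
| "ctype CEmptyInd i j = (\<^bold>\<Pi>C : cst CEmpty [] \<^bold>\<rightarrow> univ j. \<^bold>\<Pi>x : cst CEmpty []. C \<cdot> x)"
| "ctype CSum i j = univ i \<^bold>\<rightarrow> univ i \<^bold>\<rightarrow> univ i"
| "ctype CInl i j = (\<^bold>\<Pi>A : univ i. \<^bold>\<Pi>B : univ i. A \<^bold>\<rightarrow> cst CSum [A, B])"
| "ctype CInr i j = (\<^bold>\<Pi>A : univ i. \<^bold>\<Pi>B : univ i. B \<^bold>\<rightarrow> cst CSum [A, B])"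
| "ctype CSumInd i j =
     (\<^bold>\<Pi>A : univ i. \<^bold>\<Pi>B : univ i. \<^bold>\<Pi>C : cst CSum [A, B] \<^bold>\<rightarrow> univ j.
       (\<^bold>\<Pi>a : A. C \<cdot> cst CInl [A, B, a]) \<^bold>\<rightarrow> (\<^bold>\<Pi>b : B. C \<cdot> cst CInr [A, B, b]) \<^bold>\<rightarrow>
       (\<^bold>\<Pi>s : cst CSum [A, B]. C \<cdot> s))"
| "ctype CNat i j = univ i"
| "ctype CZero i j = cst CNat []"
| "ctype CSucc i j = cst CNat [] \<^bold>\<rightarrow> cst CNat []"
| "ctype CNatInd i j =
     (\<^bold>\<Pi>C : cst CNat [] \<^bold>\<rightarrow> univ j. C \<cdot> cst CZero [] \<^bold>\<rightarrow>
       (\<^bold>\<Pi>n : cst CNat []. C \<cdot> n \<^bold>\<rightarrow> C \<cdot> cst CSucc [n]) \<^bold>\<rightarrow> (\<^bold>\<Pi>n : cst CNat []. C \<cdot> n))"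
| "ctype CW i j = (\<^bold>\<Pi>A : univ i. (A \<^bold>\<rightarrow> univ i) \<^bold>\<rightarrow> univ i)"
| "ctype CSup i j =
     (\<^bold>\<Pi>A : univ i. \<^bold>\<Pi>B : A \<^bold>\<rightarrow> univ i. \<^bold>\<Pi>a : A. (B \<cdot> a \<^bold>\<rightarrow> cst CW [A, B]) \<^bold>\<rightarrow> cst CW [A, B])"
| "ctype CWInd i j =
     (\<^bold>\<Pi>A : univ i. \<^bold>\<Pi>B : A \<^bold>\<rightarrow> univ i. \<^bold>\<Pi>C : cst CW [A, B] \<^bold>\<rightarrow> univ j.
       (\<^bold>\<Pi>a : A. \<^bold>\<Pi>f : B \<cdot> a \<^bold>\<rightarrow> cst CW [A, B].
          (\<^bold>\<Pi>b : B \<cdot> a. C \<cdot> (f \<cdot> b)) \<^bold>\<rightarrow> C \<cdot> cst CSup [A, B, a, f]) \<^bold>\<rightarrow>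
       (\<^bold>\<Pi>w : cst CW [A, B]. C \<cdot> w))"
| "ctype CSigma i j = (\<^bold>\<Pi>A : univ i. (A \<^bold>\<rightarrow> univ i) \<^bold>\<rightarrow> univ i)"
| "ctype CPair i j =
     (\<^bold>\<Pi>A : univ i. \<^bold>\<Pi>B : A \<^bold>\<rightarrow> univ i. \<^bold>\<Pi>a : A. B \<cdot> a \<^bold>\<rightarrow> cst CSigma [A, B])"
| "ctype CSigmaInd i j =
     (\<^bold>\<Pi>A : univ i. \<^bold>\<Pi>B : A \<^bold>\<rightarrow> univ i. \<^bold>\<Pi>C : cst CSigma [A, B] \<^bold>\<rightarrow> univ j.
       (\<^bold>\<Pi>a : A. \<^bold>\<Pi>b : B \<cdot> a. C \<cdot> cst CPair [A, B, a, b]) \<^bold>\<rightarrow> (\<^bold>\<Pi>p : cst CSigma [A, B]. C \<cdot> p))"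
| "ctype CId i j = (\<^bold>\<Pi>A : univ i. A \<^bold>\<rightarrow> A \<^bold>\<rightarrow> univ i)"
| "ctype CRefl i j = (\<^bold>\<Pi>A : univ i. \<^bold>\<Pi>a : A. eq A a a)"
| "ctype CIdInd i j =
     (\<^bold>\<Pi>A : univ i. \<^bold>\<Pi>C : (\<^bold>\<Pi>x : A. \<^bold>\<Pi>y : A. eq A x y \<^bold>\<rightarrow> univ j).
       (\<^bold>\<Pi>x : A. C \<cdot> x \<cdot> x \<cdot> rfl A x) \<^bold>\<rightarrow> (\<^bold>\<Pi>x : A. \<^bold>\<Pi>y : A. \<^bold>\<Pi>p : eq A x y. C \<cdot> x \<cdot> y \<cdot> p))"
| "ctype CFunext i j =
     (\<^bold>\<Pi>A : univ i. \<^bold>\<Pi>B : A \<^bold>\<rightarrow> univ i. \<^bold>\<Pi>f : (\<^bold>\<Pi>x : A. B \<cdot> x). \<^bold>\<Pi>g : (\<^bold>\<Pi>x : A. B \<cdot> x).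
       isEquiv (eq (\<^bold>\<Pi>x : A. B \<cdot> x) f g) (\<^bold>\<Pi>x : A. eq (B \<cdot> x) (f \<cdot> x) (g \<cdot> x)) (happly A B f g))"
| "ctype CUnivalence i j =
     (\<^bold>\<Pi>A : univ i. \<^bold>\<Pi>B : univ i. isEquiv (eq (univ i) A B) (Equiv A B) (idtoeqv i A B))"
| "ctype CPTrunc i j = univ i \<^bold>\<rightarrow> univ i"
| "ctype CPTr i j = (\<^bold>\<Pi>A : univ i. A \<^bold>\<rightarrow> cst CPTrunc [A])"
| "ctype CPTrEq i j = (\<^bold>\<Pi>A : univ i. isProp (cst CPTrunc [A]))"
| "ctype CPTrInd i j =
     (\<^bold>\<Pi>A : univ i. \<^bold>\<Pi>C : cst CPTrunc [A] \<^bold>\<rightarrow> univ j.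
       (\<^bold>\<Pi>x : cst CPTrunc [A]. isProp (C \<cdot> x)) \<^bold>\<rightarrow> (\<^bold>\<Pi>a : A. C \<cdot> cst CPTr [A, a]) \<^bold>\<rightarrow>
       (\<^bold>\<Pi>x : cst CPTrunc [A]. C \<cdot> x))"
| "ctype CSTrunc i j = univ i \<^bold>\<rightarrow> univ i"
| "ctype CSTr i j = (\<^bold>\<Pi>A : univ i. A \<^bold>\<rightarrow> cst CSTrunc [A])"
| "ctype CSTrSet i j = (\<^bold>\<Pi>A : univ i. isSet (cst CSTrunc [A]))"
| "ctype CSTrInd i j =
     (\<^bold>\<Pi>A : univ i. \<^bold>\<Pi>C : cst CSTrunc [A] \<^bold>\<rightarrow> univ j.
       (\<^bold>\<Pi>x : cst CSTrunc [A]. isSet (C \<cdot> x)) \<^bold>\<rightarrow> (\<^bold>\<Pi>a : A. C \<cdot> cst CSTr [A, a]) \<^bold>\<rightarrow>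
       (\<^bold>\<Pi>x : cst CSTrunc [A]. C \<cdot> x))"
| "ctype CQuot i j = (\<^bold>\<Pi>A : univ i. (A \<^bold>\<rightarrow> A \<^bold>\<rightarrow> univ i) \<^bold>\<rightarrow> univ i)"
| "ctype CCls i j = (\<^bold>\<Pi>A : univ i. \<^bold>\<Pi>R : A \<^bold>\<rightarrow> A \<^bold>\<rightarrow> univ i. A \<^bold>\<rightarrow> cst CQuot [A, R])"
| "ctype CClsEq i j =
     (\<^bold>\<Pi>A : univ i. \<^bold>\<Pi>R : A \<^bold>\<rightarrow> A \<^bold>\<rightarrow> univ i. \<^bold>\<Pi>a : A. \<^bold>\<Pi>b : A. R \<cdot> a \<cdot> b \<^bold>\<rightarrow>
       eq (cst CQuot [A, R]) (cst CCls [A, R, a]) (cst CCls [A, R, b]))"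
| "ctype CQuotSet i j = (\<^bold>\<Pi>A : univ i. \<^bold>\<Pi>R : A \<^bold>\<rightarrow> A \<^bold>\<rightarrow> univ i. isSet (cst CQuot [A, R]))"
| "ctype CQuotInd i j =
     (\<^bold>\<Pi>A : univ i. \<^bold>\<Pi>R : A \<^bold>\<rightarrow> A \<^bold>\<rightarrow> univ i. \<^bold>\<Pi>C : cst CQuot [A, R] \<^bold>\<rightarrow> univ j.
       (\<^bold>\<Pi>x : cst CQuot [A, R]. isSet (C \<cdot> x)) \<^bold>\<rightarrow>
       (\<^bold>\<Pi>d : (\<^bold>\<Pi>a : A. C \<cdot> cst CCls [A, R, a]).
         (\<^bold>\<Pi>a : A. \<^bold>\<Pi>b : A. \<^bold>\<Pi>r : R \<cdot> a \<cdot> b.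
            eq (C \<cdot> cst CCls [A, R, b])
               (transport (cst CQuot [A, R]) C (cst CCls [A, R, a]) (cst CCls [A, R, b])
                  (cst CClsEq [A, R, a, b, r]) \<cdot> (d \<cdot> a))
               (d \<cdot> b)) \<^bold>\<rightarrow>
         (\<^bold>\<Pi>x : cst CQuot [A, R]. C \<cdot> x)))"

section \<open>Convertibility and typing\<close>

inductive conv :: "trm \<Rightarrow> trm \<Rightarrow> bool"  (infix "\<down>" 50) where
  conv_refl: "t \<down> t"
| conv_sym: "s \<down> t \<Longrightarrow> t \<down> s"
| conv_trans: "s \<down> t \<Longrightarrow> t \<down> u \<Longrightarrow> s \<down> u"
| conv_Pi: "A \<down> A' \<Longrightarrow> B \<down> B' \<Longrightarrow> Pi A B \<down> Pi A' B'"
| conv_Lam: "b \<down> b' \<Longrightarrow> Lam b \<down> Lam b'"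
| conv_App: "f \<down> f' \<Longrightarrow> a \<down> a' \<Longrightarrow> App f a \<down> App f' a'"
| conv_beta: "App (Lam b) a \<down> subst 0 a b"
| conv_eta: "Lam (App (lift 0 f) (Var 0)) \<down> f"
| conv_Unit: "capp CUnitInd [C, d, capp CStar []] \<down> d"
| conv_Inl: "capp CSumInd [A, B, C, d, e, capp CInl [A, B, a]] \<down> App d a"
| conv_Inr: "capp CSumInd [A, B, C, d, e, capp CInr [A, B, b]] \<down> App e b"
| conv_Zero: "capp CNatInd [C, d, e, capp CZero []] \<down> d"
| conv_Succ: "capp CNatInd [C, d, e, capp CSucc [n]] \<down>
    App (App e n) (capp CNatInd [C, d, e, n])"
| conv_Sup: "capp CWInd [A, B, C, d, capp CSup [A, B, a, f]] \<down>
    App (App (App d a) f)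
      (Lam (capp CWInd [lift 0 A, lift 0 B, lift 0 C, lift 0 d, App (lift 0 f) (Var 0)]))"
| conv_Pair: "capp CSigmaInd [A, B, C, d, capp CPair [A, B, a, b]] \<down> App (App d a) b"
| conv_Refl: "capp CIdInd [A, C, d, a, a, capp CRefl [A, a]] \<down> App d a"
| conv_PTr: "capp CPTrInd [A, C, h, d, capp CPTr [A, a]] \<down> App d a"
| conv_STr: "capp CSTrInd [A, C, h, d, capp CSTr [A, a]] \<down> App d a"
| conv_Cls: "capp CQuotInd [A, R, C, h, d, e, capp CCls [A, R, a]] \<down> App d a"

text \<open>The head of a context is the type of the most recently declared variable.\<close>

inductive ctx :: "trm list \<Rightarrow> bool"
  and typing :: "trm list \<Rightarrow> trm \<Rightarrow> trm \<Rightarrow> bool"  ("(_ \<turnstile> _ : _)" [50, 50, 50] 50) where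
  ctx_Nil: "ctx []"
| ctx_Cons: "\<Gamma> \<turnstile> A : U i \<Longrightarrow> ctx \<Gamma> \<Longrightarrow> ctx (A # \<Gamma>)"
| ty_Var: "ctx \<Gamma> \<Longrightarrow> n < length \<Gamma> \<Longrightarrow> \<Gamma> \<turnstile> Var n : (lift 0 ^^ Suc n) (\<Gamma> ! n)"
| ty_U: "ctx \<Gamma> \<Longrightarrow> \<Gamma> \<turnstile> U i : U (Suc i)"
| ty_cumul: "\<Gamma> \<turnstile> A : U i \<Longrightarrow> \<Gamma> \<turnstile> A : U (Suc i)"
| ty_Pi: "\<Gamma> \<turnstile> A : U i \<Longrightarrow> A # \<Gamma> \<turnstile> B : U i \<Longrightarrow> \<Gamma> \<turnstile> Pi A B : U i"
| ty_Lam: "A # \<Gamma> \<turnstile> b : B \<Longrightarrow> \<Gamma> \<turnstile> Lam b : Pi A B"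
| ty_App: "\<Gamma> \<turnstile> f : Pi A B \<Longrightarrow> \<Gamma> \<turnstile> a : A \<Longrightarrow> \<Gamma> \<turnstile> App f a : subst 0 a B"
| ty_Const: "ctx \<Gamma> \<Longrightarrow> \<Gamma> \<turnstile> Const c : closed (ctype c i j)"
| ty_conv: "\<Gamma> \<turnstile> a : A \<Longrightarrow> \<Gamma> \<turnstile> B : U i \<Longrightarrow> A \<down> B \<Longrightarrow> \<Gamma> \<turnstile> a : B"

definition provable :: "expr \<Rightarrow> bool" where
  "provable A \<longleftrightarrow> (\<exists>i. [] \<turnstile> closed A : U i) \<and> (\<exists>t. [] \<turnstile> t : closed A)"

section \<open>Pointed maps and the action of the fundamental group\<close>

definition PTrunc :: "expr \<Rightarrow> expr" where
  "PTrunc A = cst CPTrunc [A]"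

definition STrunc :: "expr \<Rightarrow> expr" where
  "STrunc A = cst CSTrunc [A]"

definition str :: "expr \<Rightarrow> expr \<Rightarrow> expr" where
  "str A a = cst CSTr [A, a]"

definition isConnected :: "expr \<Rightarrow> expr" where
  "isConnected X = (\<^bold>\<Pi>x : X. \<^bold>\<Pi>y : X. PTrunc (eq X x y))"

definition pmap :: "expr \<Rightarrow> expr \<Rightarrow> expr \<Rightarrow> expr \<Rightarrow> expr" where
  "pmap Z z0 X x = (\<^bold>\<Sigma>f : Z \<^bold>\<rightarrow> X. eq X (f \<cdot> z0) x)"

definition forget :: "expr \<Rightarrow> expr \<Rightarrow> expr \<Rightarrow> expr \<Rightarrow> expr \<Rightarrow> expr" where
  "forget Z z0 X x g = pr1 (Z \<^bold>\<rightarrow> X) (\<lambda>f. eq X (f \<cdot> z0) x) g"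

definition pi1 :: "expr \<Rightarrow> expr \<Rightarrow> expr" where
  "pi1 X x0 = STrunc (eq X x0 x0)"

text \<open>
  The action on truncated loops is defined by recursion on the set truncation, into the set
  \<open>STrunc (pmap Z z0 X x0)\<close>.
\<close>

definition act :: "expr \<Rightarrow> expr \<Rightarrow> expr \<Rightarrow> expr \<Rightarrow> expr \<Rightarrow> expr \<Rightarrow> expr" where
  "act Z z0 X x0 g l =
     cst CSTrInd [eq X x0 x0,
       \<^bold>\<lambda>_. STrunc (pmap Z z0 X x0),
       \<^bold>\<lambda>_. cst CSTrSet [pmap Z z0 X x0],
       \<^bold>\<lambda>p. transport X (\<^bold>\<lambda>x. STrunc (pmap Z z0 X x)) x0 x0 p \<cdot> g,
       l]"

definition orbitRel :: "expr \<Rightarrow> expr \<Rightarrow> expr \<Rightarrow> expr \<Rightarrow> expr" where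
  "orbitRel Z z0 X x0 =
     (\<^bold>\<lambda>g1. \<^bold>\<lambda>g2. PTrunc (\<^bold>\<Sigma>l : pi1 X x0. eq (STrunc (pmap Z z0 X x0)) (act Z z0 X x0 g1 l) g2))"

definition Orbits :: "expr \<Rightarrow> expr \<Rightarrow> expr \<Rightarrow> expr \<Rightarrow> expr" where
  "Orbits Z z0 X x0 = cst CQuot [STrunc (pmap Z z0 X x0), orbitRel Z z0 X x0]"

definition orbit :: "expr \<Rightarrow> expr \<Rightarrow> expr \<Rightarrow> expr \<Rightarrow> expr \<Rightarrow> expr" where
  "orbit Z z0 X x0 g = cst CCls [STrunc (pmap Z z0 X x0), orbitRel Z z0 X x0, g]"

text \<open>
  \<open>F\<close> is the map on orbits induced by forgetting pointedness.  As \<open>STrunc (Z \<rightarrow> X)\<close> is a set and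
  the orbits of truncated pointed maps exhaust the orbit set, this determines \<open>F\<close> up to homotopy.
\<close>

definition isInduced :: "expr \<Rightarrow> expr \<Rightarrow> expr \<Rightarrow> expr \<Rightarrow> expr \<Rightarrow> expr" where
  "isInduced Z z0 X x0 F =
     (\<^bold>\<Pi>g : pmap Z z0 X x0.
        eq (STrunc (Z \<^bold>\<rightarrow> X)) (F \<cdot> orbit Z z0 X x0 (str (pmap Z z0 X x0) g))
           (str (Z \<^bold>\<rightarrow> X) (forget Z z0 X x0 g)))"

end

theory Submission
  imports Defs
begin

text \<open>
  The idea. Write \<open>[f, w]\<close> for the orbit of the pointed map given by \<open>f : Z \<rightarrow> X\<close> and
  \<open>w : f z0 = x0\<close>. Transporting \<open>(f, w)\<close> along \<open>p : x = y\<close> yields \<open>(f, w p)\<close>, by induction on \<open>p\<close>. Hence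
  two pointings \<open>w\<close> and \<open>v\<close> of the same \<open>f\<close> differ by the loop \<open>w\<inverse> v\<close>, so that \<open>[f, w] = [f, v]\<close>
  (\<open>Orbit_basing_invariant\<close>). In the other direction, transport does not change the underlying free map, so
  that \<open>(f, w) \<mapsto> f\<close> descends to a map \<open>F\<close> on orbits (\<open>Orbit_map\<close>).

  The inverse \<open>G\<close> has to send \<open>f\<close> to \<open>[f, w]\<close>, but connectedness of \<open>X\<close> only gives a mere \<open>w\<close>. As \<open>[f, w]\<close>
  does not depend on \<open>w\<close>, the pairs of an orbit \<open>k\<close> and a proof that merely \<open>k = [f, w]\<close> for some \<open>w\<close> form a
  proposition, and the truncation can be eliminated into it (\<open>Unique_value\<close>, \<open>Class_choice\<close>). Both
  composites are then computed on representatives. This route needs only the elimination rules of the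
  truncations and of the quotient: injectivity of \<open>F\<close> would ask when \<open>|f| = |g|\<close> holds in a set
  truncation, which is characterised by means of univalence; exhibiting \<open>G\<close> avoids the question.

  The formal side. Derivability of a type is shown by exhibiting a term and running a type checker on it.
  The checker is a function on raw terms that is proved sound for the typing relation
  (\<open>checker_sound\<close>), which rests on weakening and substitution for typing derivations. A longer
  development is cut into closed types that are proved one after the other: earlier results enter the
  term of a later one as bound variables, and \<open>provable_by\<close> discharges them. They are
  opaque there, which keeps all types small. Everything is checked in the lowest universe; raising all
  levels in a derivation by \<open>i\<close> gives the theorem for the universe at level \<open>i\<close> (\<open>typing_raise\<close>).
\<close>

section \<open>Parallel substitution\<close>

definition up :: "(nat \<Rightarrow> trm) \<Rightarrow> nat \<Rightarrow> trm" where
  "up \<sigma> n = (case n of 0 \<Rightarrow> Var 0 | Suc m \<Rightarrow> lift 0 (\<sigma> m))"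

primrec psubst :: "(nat \<Rightarrow> trm) \<Rightarrow> trm \<Rightarrow> trm" where
  "psubst \<sigma> (Var n) = \<sigma> n"
| "psubst \<sigma> (U i) = U i"
| "psubst \<sigma> (Pi A B) = Pi (psubst \<sigma> A) (psubst (up \<sigma>) B)"
| "psubst \<sigma> (Lam b) = Lam (psubst (up \<sigma>) b)"
| "psubst \<sigma> (App f a) = App (psubst \<sigma> f) (psubst \<sigma> a)"
| "psubst \<sigma> (Const c) = Const c"

lemma up_simps [simp]: "up \<sigma> 0 = Var 0" "up \<sigma> (Suc m) = lift 0 (\<sigma> m)"
  by (simp_all add: up_def)

lemma lift_eq_psubst: "lift k t = psubst (\<lambda>n. if n < k then Var n else Var (Suc n)) t"
proof (induction t arbitrary: k)
  have up: "up (\<lambda>n. if n < k then Var n else Var (Suc n))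
    = (\<lambda>n. if n < Suc k then Var n else Var (Suc n))" for k
    by (rule ext) (auto simp: up_def split: nat.split)
  {
    case (Pi A B) then show ?case by (simp add: up)
  next
    case (Lam b) then show ?case by (simp add: up)
  }
qed auto

lemma subst_eq_psubst:
  "subst k u t = psubst (\<lambda>n. if n < k then Var n else if n = k then u else Var (n - 1)) t"
proof (induction t arbitrary: k u)
  have up: "up (\<lambda>n. if n < k then Var n else if n = k then u else Var (n - 1))
    = (\<lambda>n. if n < Suc k then Var n else if n = Suc k then lift 0 u else Var (n - 1))" for k u
    by (rule ext) (auto simp: up_def split: nat.split)
  {
    case (Pi A B) then show ?case by (simp add: up)
  next
    case (Lam b) then show ?case by (simp add: up)
  }
qed auto

lemma lift_lift: "i \<le> k \<Longrightarrow> lift (Suc k) (lift i t) = lift i (lift k t)"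
  by (induction t arbitrary: i k) auto

lemma psubst_lift: "psubst \<tau> (lift k t) = psubst (\<lambda>n. \<tau> (if n < k then n else Suc n)) t"
proof (induction t arbitrary: k \<tau>)
  have up: "(\<lambda>n. up \<tau> (if n < Suc k then n else Suc n))
    = up (\<lambda>n. \<tau> (if n < k then n else Suc n))" for \<tau> k
    by (rule ext) (auto simp: up_def split: nat.split)
  {
    case (Pi A B) then show ?case by (simp add: up)
  next
    case (Lam b) then show ?case by (simp add: up)
  }
qed auto

lemma lift_psubst: "lift k (psubst \<tau> t) = psubst (\<lambda>n. lift k (\<tau> n)) t"
proof (induction t arbitrary: k \<tau>)
  have up: "(\<lambda>n. lift (Suc k) (up \<tau> n)) = up (\<lambda>n. lift k (\<tau> n))" for \<tau> k
    by (rule ext) (auto simp: up_def lift_lift split: nat.split)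
  {
    case (Pi A B) then show ?case by (simp add: up)
  next
    case (Lam b) then show ?case by (simp add: up)
  }
qed auto

lemma psubst_up_lift: "psubst (up \<sigma>) (lift 0 t) = lift 0 (psubst \<sigma> t)"
  by (simp add: psubst_lift lift_psubst)

lemma psubst_psubst: "psubst \<tau> (psubst \<sigma> t) = psubst (\<lambda>n. psubst \<tau> (\<sigma> n)) t"
proof (induction t arbitrary: \<sigma> \<tau>)
  have up: "(\<lambda>n. psubst (up \<tau>) (up \<sigma> n)) = up (\<lambda>n. psubst \<tau> (\<sigma> n))" for \<sigma> \<tau>
    by (rule ext) (auto simp: up_def psubst_up_lift split: nat.split)
  {
    case (Pi A B) then show ?case by (simp add: up)
  next
    case (Lam b) then show ?case by (simp add: up)
  }
qed auto

lemma up_Var [simp]: "up Var = Var"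
  by (rule ext) (auto simp: up_def split: nat.split)

lemma psubst_Var [simp]: "psubst Var t = t"
  by (induction t) auto

lemma subst_0_lift [simp]: "subst 0 u (lift 0 t) = t"
  by (simp add: subst_eq_psubst psubst_lift)

lemma psubst_subst:
  "psubst \<sigma> (subst 0 a B) = subst 0 (psubst \<sigma> a) (psubst (up \<sigma>) B)"
proof -
  have "(\<lambda>n. psubst \<sigma> (if n < 0 then Var n else if n = 0 then a else Var (n - 1)))
      = (\<lambda>n. subst 0 (psubst \<sigma> a) (up \<sigma> n))"
    by (rule ext) (auto simp: up_def split: nat.split)
  then show ?thesis
    unfolding subst_eq_psubst[of 0 a] psubst_psubst
    unfolding subst_eq_psubst psubst_psubst by simp
qed

primrec fv_below :: "nat \<Rightarrow> trm \<Rightarrow> bool" where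
  "fv_below k (Var n) \<longleftrightarrow> n < k"
| "fv_below k (U i) \<longleftrightarrow> True"
| "fv_below k (Pi A B) \<longleftrightarrow> fv_below k A \<and> fv_below (Suc k) B"
| "fv_below k (Lam b) \<longleftrightarrow> fv_below (Suc k) b"
| "fv_below k (App f a) \<longleftrightarrow> fv_below k f \<and> fv_below k a"
| "fv_below k (Const c) \<longleftrightarrow> True"

lemma psubst_fv_below: "fv_below k t \<Longrightarrow> (\<And>n. n < k \<Longrightarrow> \<sigma> n = Var n) \<Longrightarrow> psubst \<sigma> t = t"
proof (induction t arbitrary: k \<sigma>)
  have up: "\<forall>n < Suc k. up \<sigma> n = Var n" if "\<And>n. n < k \<Longrightarrow> \<sigma> n = Var n" for k and \<sigma> :: "nat \<Rightarrow> trm"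
    using that by (auto simp: up_def split: nat.split)
  {
    case (Pi A B) with up[of k \<sigma>] show ?case by auto
  next
    case (Lam b) with up[of k \<sigma>] show ?case by auto
  }
qed auto

corollary psubst_closed: "fv_below 0 t \<Longrightarrow> psubst \<sigma> t = t"
  by (rule psubst_fv_below) auto

lemmas hott_defs = closed_def lam_def pi_def bind_def app_def univ_def cst_def sigma_def arrow_def
  times_def pair_def pr1_def eq_def rfl_def transport_def isProp_def isSet_def rinv_def linv_def
  isEquiv_def Equiv_def idEquiv_def idtoeqv_def happly_def capp_def Let_def

lemma fv_below_ctype: "fv_below 0 (closed (ctype c i j))"
  by (cases c) (simp_all add: hott_defs)

section \<open>Stability of typing under substitution\<close>

lemma conv_psubst: "s \<down> t \<Longrightarrow> psubst \<sigma> s \<down> psubst \<sigma> t"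
proof (induction arbitrary: \<sigma> rule: conv.induct)
  case (conv_beta b a) then show ?case
    by (simp add: psubst_subst conv.conv_beta)
next
  case (conv_eta f) then show ?case
    by (simp add: psubst_up_lift conv.conv_eta)
next
  case (conv_Sup A B C d a f)
  show ?case
    using conv.conv_Sup[of "psubst \<sigma> A" "psubst \<sigma> B" "psubst \<sigma> C" "psubst \<sigma> d" "psubst \<sigma> a" "psubst \<sigma> f"]
    by (simp add: capp_def psubst_up_lift)
qed (auto simp: capp_def intro: conv.intros[unfolded capp_def, simplified])

lemma ctx_of_typing: "\<Gamma> \<turnstile> t : A \<Longrightarrow> ctx \<Gamma>"
  by (induction rule: ctx_typing.inducts(2)[where ?P1.0 = "\<lambda>_. True"]) (auto elim: ctx.cases)

lemma ctx_ConsD: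
  assumes "ctx (A # \<Gamma>)" obtains i where "\<Gamma> \<turnstile> A : U i" "ctx \<Gamma>"
  using assms by (auto elim: ctx.cases)

text \<open>
  Renamings and general substitutions are handled by the same induction: \<open>M \<Gamma> \<sigma> \<Gamma>'\<close> is a class of
  substitutions from \<open>\<Gamma>\<close> to \<open>\<Gamma>'\<close> that send variables to well-typed terms and can be pushed under a
  binder. For general substitutions the second property is weakening, that is, the instance for
  renamings.

  The rule for abstractions does not say that the domain \<open>A\<close> is a type, although the context
  extended by the substituted domain must be well formed to use the induction hypothesis. The statement
  is therefore proved together with \<open>K \<Gamma>\<close>, the same property for every type declared in the context.
\<close>

lemma typing_psubst_class:
  fixes M :: "trm list \<Rightarrow> (nat \<Rightarrow> trm) \<Rightarrow> trm list \<Rightarrow> bool"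
  assumes var: "\<And>\<Gamma> \<sigma> \<Gamma>' n. M \<Gamma> \<sigma> \<Gamma>' \<Longrightarrow> ctx \<Gamma>' \<Longrightarrow> n < length \<Gamma> \<Longrightarrow>
      \<Gamma>' \<turnstile> \<sigma> n : psubst \<sigma> ((lift 0 ^^ Suc n) (\<Gamma> ! n))"
    and up: "\<And>\<Gamma> \<sigma> \<Gamma>' A. M \<Gamma> \<sigma> \<Gamma>' \<Longrightarrow> ctx (psubst \<sigma> A # \<Gamma>') \<Longrightarrow>
      M (A # \<Gamma>) (up \<sigma>) (psubst \<sigma> A # \<Gamma>')"
  shows "\<Gamma> \<turnstile> t : A \<Longrightarrow> M \<Gamma> \<sigma> \<Gamma>' \<Longrightarrow> ctx \<Gamma>' \<Longrightarrow> \<Gamma>' \<turnstile> psubst \<sigma> t : psubst \<sigma> A"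
proof -
  define ty where "ty \<Gamma> t A \<longleftrightarrow>
    (\<forall>\<sigma> \<Gamma>'. M \<Gamma> \<sigma> \<Gamma>' \<longrightarrow> ctx \<Gamma>' \<longrightarrow> \<Gamma>' \<turnstile> psubst \<sigma> t : psubst \<sigma> A)" for \<Gamma> t A
  define K where "K \<Gamma> \<longleftrightarrow> (\<forall>\<Delta> A \<Gamma>0. \<Gamma> = \<Delta> @ A # \<Gamma>0 \<longrightarrow> (\<exists>i. ty \<Gamma>0 A (U i)))" for \<Gamma>
  have K_Cons: "K (A # \<Gamma>) \<longleftrightarrow> (\<exists>i. ty \<Gamma> A (U i)) \<and> K \<Gamma>" for A \<Gamma>
    unfolding K_def by (auto simp: Cons_eq_append_conv)
  have up': "M (A # \<Gamma>) (up \<sigma>) (psubst \<sigma> A # \<Gamma>') \<and> ctx (psubst \<sigma> A # \<Gamma>')"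
    if "M \<Gamma> \<sigma> \<Gamma>'" "ctx \<Gamma>'" "ty \<Gamma> A (U i)" for A \<Gamma> \<sigma> \<Gamma>' i
    using that up ctx_Cons unfolding ty_def by fastforce
  have "(ctx \<Gamma> \<longrightarrow> K \<Gamma>) \<and> (\<Gamma> \<turnstile> t : A \<longrightarrow> K \<Gamma> \<and> ty \<Gamma> t A)" for \<Gamma> t A
  proof (induction rule: ctx_typing.induct)
    case ctx_Nil show ?case by (simp add: K_def)
  next
    case (ctx_Cons \<Gamma> A i) then show ?case by (auto simp: K_Cons)
  next
    case (ty_Var \<Gamma> n) then show ?case using var by (auto simp: ty_def)
  next
    case (ty_U \<Gamma> i) then show ?case by (auto simp: ty_def intro: ctx_typing.ty_U)
  next
    case (ty_cumul \<Gamma> A i) then show ?case by (auto simp: ty_def intro: ctx_typing.ty_cumul)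
  next
    case (ty_Pi \<Gamma> A i B)
    have "ty \<Gamma> (Pi A B) (U i)"
      unfolding ty_def
    proof (intro allI impI)
      fix \<sigma> \<Gamma>' assume M: "M \<Gamma> \<sigma> \<Gamma>'" "ctx \<Gamma>'"
      from ty_Pi up'[OF M] have "psubst \<sigma> A # \<Gamma>' \<turnstile> psubst (up \<sigma>) B : U i"
        unfolding ty_def by fastforce
      moreover from ty_Pi M have "\<Gamma>' \<turnstile> psubst \<sigma> A : U i" unfolding ty_def by fastforce
      ultimately show "\<Gamma>' \<turnstile> psubst \<sigma> (Pi A B) : psubst \<sigma> (U i)"
        by (simp add: ctx_typing.ty_Pi)
    qed
    with ty_Pi show ?case by blast
  next
    case (ty_Lam A \<Gamma> b B)
    then obtain i where A: "ty \<Gamma> A (U i)" by (auto simp: K_Cons)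
    have "ty \<Gamma> (Lam b) (Pi A B)"
      unfolding ty_def
    proof (intro allI impI)
      fix \<sigma> \<Gamma>' assume M: "M \<Gamma> \<sigma> \<Gamma>'" "ctx \<Gamma>'"
      from ty_Lam up'[OF M A] have "psubst \<sigma> A # \<Gamma>' \<turnstile> psubst (up \<sigma>) b : psubst (up \<sigma>) B"
        unfolding ty_def by blast
      then show "\<Gamma>' \<turnstile> psubst \<sigma> (Lam b) : psubst \<sigma> (Pi A B)"
        by (simp add: ctx_typing.ty_Lam)
    qed
    with ty_Lam show ?case by (auto simp: K_Cons)
  next
    case (ty_App \<Gamma> f A B a)
    have "ty \<Gamma> (App f a) (subst 0 a B)"
      unfolding ty_def
    proof (intro allI impI)
      fix \<sigma> \<Gamma>' assume M: "M \<Gamma> \<sigma> \<Gamma>'" "ctx \<Gamma>'"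
      with ty_App have "\<Gamma>' \<turnstile> psubst \<sigma> f : Pi (psubst \<sigma> A) (psubst (up \<sigma>) B)"
        "\<Gamma>' \<turnstile> psubst \<sigma> a : psubst \<sigma> A" by (simp_all add: ty_def)
      from ctx_typing.ty_App[OF this]
      show "\<Gamma>' \<turnstile> psubst \<sigma> (App f a) : psubst \<sigma> (subst 0 a B)"
        by (simp add: psubst_subst)
    qed
    with ty_App show ?case by blast
  next
    case (ty_Const \<Gamma> c i j) then show ?case
      by (auto simp: ty_def psubst_closed fv_below_ctype intro: ctx_typing.ty_Const)
  next
    case (ty_conv \<Gamma> a A B i)
    have "ty \<Gamma> a B"
      unfolding ty_def
    proof (intro allI impI)
      fix \<sigma> \<Gamma>' assume M: "M \<Gamma> \<sigma> \<Gamma>'" "ctx \<Gamma>'"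
      with ty_conv have "\<Gamma>' \<turnstile> psubst \<sigma> a : psubst \<sigma> A" "\<Gamma>' \<turnstile> psubst \<sigma> B : U i"
        by (simp_all add: ty_def)
      then show "\<Gamma>' \<turnstile> psubst \<sigma> a : psubst \<sigma> B"
        using ctx_typing.ty_conv conv_psubst[OF ty_conv(3)] by blast
    qed
    with ty_conv show ?case by blast
  qed
  then show "\<Gamma> \<turnstile> t : A \<Longrightarrow> M \<Gamma> \<sigma> \<Gamma>' \<Longrightarrow> ctx \<Gamma>' \<Longrightarrow> \<Gamma>' \<turnstile> psubst \<sigma> t : psubst \<sigma> A"
    by (simp add: ty_def)
qed

lemma typing_psubst_Var:
  assumes "\<Gamma> \<turnstile> t : A" "ctx \<Gamma>'"
    and "\<And>n. n < length \<Gamma> \<Longrightarrow> \<rho> n < length \<Gamma>' \<and>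
      (lift 0 ^^ Suc (\<rho> n)) (\<Gamma>' ! \<rho> n) = psubst (\<lambda>n. Var (\<rho> n)) ((lift 0 ^^ Suc n) (\<Gamma> ! n))"
  shows "\<Gamma>' \<turnstile> psubst (\<lambda>n. Var (\<rho> n)) t : psubst (\<lambda>n. Var (\<rho> n)) A"
proof (rule typing_psubst_class[where M = "\<lambda>\<Gamma> \<sigma> \<Gamma>'. \<forall>n < length \<Gamma>. \<exists>m < length \<Gamma>'.
    \<sigma> n = Var m \<and> (lift 0 ^^ Suc m) (\<Gamma>' ! m) = psubst \<sigma> ((lift 0 ^^ Suc n) (\<Gamma> ! n))"])
  fix \<Gamma> \<sigma> \<Gamma>' n
  assume "\<forall>n < length \<Gamma>. \<exists>m < length \<Gamma>'.
    \<sigma> n = Var m \<and> (lift 0 ^^ Suc m) (\<Gamma>' ! m) = psubst \<sigma> ((lift 0 ^^ Suc n) (\<Gamma> ! n))"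
    and "ctx \<Gamma>'" "n < length \<Gamma>"
  then show "\<Gamma>' \<turnstile> \<sigma> n : psubst \<sigma> ((lift 0 ^^ Suc n) (\<Gamma> ! n))"
    using ty_Var by metis
next
  fix \<Gamma> \<sigma> \<Gamma>' A
  assume *: "\<forall>n < length \<Gamma>. \<exists>m < length \<Gamma>'.
    \<sigma> n = Var m \<and> (lift 0 ^^ Suc m) (\<Gamma>' ! m) = psubst \<sigma> ((lift 0 ^^ Suc n) (\<Gamma> ! n))"
  show "\<forall>n < length (A # \<Gamma>). \<exists>m < length (psubst \<sigma> A # \<Gamma>'). up \<sigma> n = Var m \<and>
    (lift 0 ^^ Suc m) ((psubst \<sigma> A # \<Gamma>') ! m) = psubst (up \<sigma>) ((lift 0 ^^ Suc n) ((A # \<Gamma>) ! n))"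
  proof (intro allI impI)
    fix n assume n: "n < length (A # \<Gamma>)"
    show "\<exists>m < length (psubst \<sigma> A # \<Gamma>'). up \<sigma> n = Var m \<and>
      (lift 0 ^^ Suc m) ((psubst \<sigma> A # \<Gamma>') ! m) = psubst (up \<sigma>) ((lift 0 ^^ Suc n) ((A # \<Gamma>) ! n))"
    proof (cases n)
      case 0 then show ?thesis by (auto intro!: exI[of _ 0] simp: psubst_up_lift)
    next
      case (Suc n')
      with n * obtain m where "m < length \<Gamma>'" "\<sigma> n' = Var m"
        "(lift 0 ^^ Suc m) (\<Gamma>' ! m) = psubst \<sigma> ((lift 0 ^^ Suc n') (\<Gamma> ! n'))" by auto
      with Suc show ?thesis by (auto intro!: exI[of _ "Suc m"] simp: psubst_up_lift)
    qed
  qed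
qed (use assms in auto)

lemma weakening:
  assumes "\<Gamma> \<turnstile> t : A" "ctx (B # \<Gamma>)"
  shows "B # \<Gamma> \<turnstile> lift 0 t : lift 0 A"
  using typing_psubst_Var[OF assms, of Suc] by (simp add: lift_eq_psubst)

lemma typing_psubst:
  assumes "\<Gamma> \<turnstile> t : A" "ctx \<Gamma>'"
    and "\<And>n. n < length \<Gamma> \<Longrightarrow> \<Gamma>' \<turnstile> \<sigma> n : psubst \<sigma> ((lift 0 ^^ Suc n) (\<Gamma> ! n))"
  shows "\<Gamma>' \<turnstile> psubst \<sigma> t : psubst \<sigma> A"
proof (rule typing_psubst_class[where M = "\<lambda>\<Gamma> \<sigma> \<Gamma>'. \<forall>n < length \<Gamma>.
    \<Gamma>' \<turnstile> \<sigma> n : psubst \<sigma> ((lift 0 ^^ Suc n) (\<Gamma> ! n))"])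
  fix \<Gamma> \<sigma> \<Gamma>' A
  assume *: "\<forall>n < length \<Gamma>. \<Gamma>' \<turnstile> \<sigma> n : psubst \<sigma> ((lift 0 ^^ Suc n) (\<Gamma> ! n))"
    and ctx: "ctx (psubst \<sigma> A # \<Gamma>')"
  show "\<forall>n < length (A # \<Gamma>).
    psubst \<sigma> A # \<Gamma>' \<turnstile> up \<sigma> n : psubst (up \<sigma>) ((lift 0 ^^ Suc n) ((A # \<Gamma>) ! n))"
  proof (intro allI impI)
    fix n assume n: "n < length (A # \<Gamma>)"
    show "psubst \<sigma> A # \<Gamma>' \<turnstile> up \<sigma> n : psubst (up \<sigma>) ((lift 0 ^^ Suc n) ((A # \<Gamma>) ! n))"
    proof (cases n)
      case 0 then show ?thesis using ty_Var[OF ctx, of 0] by (simp add: psubst_up_lift)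
    next
      case (Suc n')
      with n * have "\<Gamma>' \<turnstile> \<sigma> n' : psubst \<sigma> ((lift 0 ^^ Suc n') (\<Gamma> ! n'))" by simp
      from weakening[OF this ctx] Suc show ?thesis by (simp add: psubst_up_lift)
    qed
  qed
qed (use assms in auto)

lemma substitution:
  assumes t: "A # \<Gamma> \<turnstile> t : B" and a: "\<Gamma> \<turnstile> a : A"
  shows "\<Gamma> \<turnstile> subst 0 a t : subst 0 a B"
  unfolding subst_eq_psubst
proof (rule typing_psubst[OF t ctx_of_typing[OF a]])
  fix n assume n: "n < length (A # \<Gamma>)"
  let ?\<sigma> = "\<lambda>n. if n < 0 then Var n else if n = 0 then a else Var (n - 1)"
  have *: "psubst ?\<sigma> (lift 0 s) = s" for s
    using subst_0_lift[of a s] by (simp only: subst_eq_psubst)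
  show "\<Gamma> \<turnstile> ?\<sigma> n : psubst ?\<sigma> ((lift 0 ^^ Suc n) ((A # \<Gamma>) ! n))"
    using a n ty_Var[OF ctx_of_typing[OF a], of "n - 1"] *
    by (cases n) (simp_all del: less_nat_zero_code)
qed

lemma weakening_closed:
  assumes "[] \<turnstile> t : A" "fv_below 0 t" "fv_below 0 A" "ctx \<Gamma>"
  shows "\<Gamma> \<turnstile> t : A"
  using typing_psubst[OF assms(1,4), of Var] by simp

lemma Pi_inversion:
  assumes "\<Gamma> \<turnstile> Pi A B : T"
  obtains i where "\<Gamma> \<turnstile> A : U i" "A # \<Gamma> \<turnstile> B : U i"
proof -
  have "\<exists>i. \<Gamma> \<turnstile> A : U i \<and> A # \<Gamma> \<turnstile> B : U i" if "\<Gamma> \<turnstile> P : T" "P = Pi A B" for P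
    using that
    by (induction rule: ctx_typing.inducts(2)[where ?P1.0 = "\<lambda>_. True"]) auto
  with assms that show thesis by blast
qed

lemma cumul_le:
  assumes "\<Gamma> \<turnstile> A : U i" "i \<le> j"
  shows "\<Gamma> \<turnstile> A : U j"
  using assms(2,1) by (induction rule: dec_induct) (auto intro: ty_cumul)

section \<open>Raising universe levels\<close>

primrec raise :: "nat \<Rightarrow> trm \<Rightarrow> trm" where
  "raise k (Var n) = Var n"
| "raise k (U i) = U (i + k)"
| "raise k (Pi A B) = Pi (raise k A) (raise k B)"
| "raise k (Lam b) = Lam (raise k b)"
| "raise k (App f a) = App (raise k f) (raise k a)"
| "raise k (Const c) = Const c"

lemma raise_lift: "raise k (lift n t) = lift n (raise k t)"
  by (induction t arbitrary: n) auto

lemma raise_lift_funpow: "raise k ((lift 0 ^^ n) t) = (lift 0 ^^ n) (raise k t)"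
  by (induction n) (auto simp: raise_lift)

lemma raise_subst: "raise k (subst n u t) = subst n (raise k u) (raise k t)"
  by (induction t arbitrary: n u) (auto simp: raise_lift)

lemma conv_raise: "s \<down> t \<Longrightarrow> raise k s \<down> raise k t"
proof (induction rule: conv.induct)
  case (conv_beta b a) then show ?case
    by (simp add: raise_subst conv.conv_beta)
next
  case (conv_eta f) then show ?case
    by (simp add: raise_lift conv.conv_eta)
next
  case (conv_Sup A B C d a f)
  show ?case
    using conv.conv_Sup[of "raise k A" "raise k B" "raise k C" "raise k d" "raise k a" "raise k f"]
    by (simp add: capp_def raise_lift)
qed (auto simp: capp_def intro: conv.intros[unfolded capp_def, simplified])

lemma raise_ctype: "raise k (closed (ctype c i j)) = closed (ctype c (i + k) (j + k))"
  by (cases c) (simp_all add: hott_defs)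

text \<open>
  The constants have their types at all levels, so that a derivation stays a derivation when all
  universes in it are raised by the same amount.
\<close>

lemma typing_raise:
  "(ctx \<Gamma> \<longrightarrow> ctx (map (raise k) \<Gamma>)) \<and> (\<Gamma> \<turnstile> t : A \<longrightarrow> map (raise k) \<Gamma> \<turnstile> raise k t : raise k A)"
proof (induction rule: ctx_typing.induct)
  case (ty_Var \<Gamma> n) then show ?case
    using ctx_typing.ty_Var[of "map (raise k) \<Gamma>" n] by (simp add: raise_lift raise_lift_funpow)
next
  case (ty_App \<Gamma> f A B a) then show ?case
    using ctx_typing.ty_App[of "map (raise k) \<Gamma>" "raise k f" "raise k A" "raise k B" "raise k a"]
    by (simp add: raise_subst)
next
  case (ty_Const \<Gamma> c i j) then show ?case by (simp add: raise_ctype ctx_typing.ty_Const)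
next
  case (ty_conv \<Gamma> a A B i)
  then have "map (raise k) \<Gamma> \<turnstile> raise k a : raise k A" "map (raise k) \<Gamma> \<turnstile> raise k B : U (i + k)"
    by simp_all
  then show ?case using ctx_typing.ty_conv conv_raise[OF ty_conv(3)] by blast
qed (simp_all, (rule ctx_typing.intros; simp; fail)+)

section \<open>Type checking\<close>

text \<open>The accumulator \<open>as\<close> holds the arguments that have been split off.\<close>

fun strip :: "trm \<Rightarrow> trm list \<Rightarrow> trm \<times> trm list" where
  "strip (App f a) as = strip f (a # as)"
| "strip t as = (t, as)"

text \<open>
  The computation rules of the eliminators for paths, pairs, truncations and quotients; these are
  the type formers of the proof below. The repeated parameters of eliminator and constructor have to
  agree syntactically, as the conversion rules require.
\<close>

definition iota :: "const \<Rightarrow> trm list \<Rightarrow> trm option" where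
  "iota c ts = (case ts of
      [A, C, d, x, y, p] \<Rightarrow>
        if c = CIdInd \<and> x = y \<and> p = capp CRefl [A, x] then Some (App d x) else None
    | [A, B, C, d, p] \<Rightarrow> (case strip p [] of
        (h, [A', B', a, b]) \<Rightarrow>
          if c = CSigmaInd \<and> h = Const CPair \<and> A' = A \<and> B' = B then Some (App (App d a) b) else None
      | (h, [A', a]) \<Rightarrow>
          if (c = CPTrInd \<and> h = Const CPTr \<or> c = CSTrInd \<and> h = Const CSTr) \<and> A' = A
          then Some (App d a) else None
      | _ \<Rightarrow> None)
    | [A, R, C, h, d, e, p] \<Rightarrow> (case strip p [] of
        (h, [A', R', a]) \<Rightarrow>
          if c = CQuotInd \<and> h = Const CCls \<and> A' = A \<and> R' = R then Some (App d a) else None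
      | _ \<Rightarrow> None)
    | _ \<Rightarrow> None)"

definition contract :: "trm \<Rightarrow> trm" where
  "contract t = (case t of
      App (Lam b) a \<Rightarrow> subst 0 a b
    | _ \<Rightarrow> (case strip t [] of
        (Const c, ts) \<Rightarrow> (case iota c ts of Some t' \<Rightarrow> t' | None \<Rightarrow> t)
      | _ \<Rightarrow> t))"

text \<open>One parallel pass over the term, innermost redexes first.\<close>

primrec reduce :: "trm \<Rightarrow> trm" where
  "reduce (Var n) = Var n"
| "reduce (U i) = U i"
| "reduce (Pi A B) = Pi (reduce A) (reduce B)"
| "reduce (Lam b) = Lam (reduce b)"
| "reduce (App f a) = contract (App (reduce f) (reduce a))"
| "reduce (Const c) = Const c"

primrec norm :: "nat \<Rightarrow> trm \<Rightarrow> trm" where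
  "norm 0 t = t"
| "norm (Suc k) t = (let t' = reduce t in if t' = t then t else norm k t')"

text \<open>
  No pass of \<open>reduce\<close> changes the head of a rigid term, so that reduction can make two rigid terms
  equal only componentwise. Comparing the components first confines reduction to the small
  subterms that really differ.
\<close>

definition rigid :: "trm \<Rightarrow> bool" where
  "rigid t \<longleftrightarrow> (case fst (strip t []) of
      Lam b \<Rightarrow> snd (strip t []) = []
    | Const c \<Rightarrow> c \<notin> {CIdInd, CSigmaInd, CPTrInd, CSTrInd, CQuotInd}
    | _ \<Rightarrow> True)"

primrec convertible :: "nat \<Rightarrow> trm \<Rightarrow> trm \<Rightarrow> bool" where
  "convertible 0 s t \<longleftrightarrow> s = t"
| "convertible (Suc k) s t \<longleftrightarrow> s = t \<or>
    (if rigid s \<and> rigid t then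
       (case s of
         Pi A B \<Rightarrow> (case t of Pi A' B' \<Rightarrow> convertible k A A' \<and> convertible k B B' | _ \<Rightarrow> False)
       | Lam b \<Rightarrow> (case t of Lam b' \<Rightarrow> convertible k b b' | _ \<Rightarrow> False)
       | App f a \<Rightarrow> (case t of App f' a' \<Rightarrow> convertible k f f' \<and> convertible k a a' | _ \<Rightarrow> False)
       | _ \<Rightarrow> False)
     else convertible k (reduce s) (reduce t))"

text \<open>
  The number bounds the depth of the recursion, and running out of it means rejection. Only the
  constants in \<open>S\<close> are accepted, so that the well-formedness of their types can be established
  one constant at a time.

  \<open>expose\<close> presents a type as a dependent product. If this needs reduction, the normal form is
  checked again to be a type: the conversion relation compares raw terms, and it would take
  a subject reduction theorem to know that reducts of types are types.
\<close>

fun infer :: "const list \<Rightarrow> nat \<Rightarrow> trm list \<Rightarrow> trm \<Rightarrow> trm option"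
  and expose :: "const list \<Rightarrow> nat \<Rightarrow> trm list \<Rightarrow> trm \<Rightarrow> (trm \<times> trm) option"
  and check :: "const list \<Rightarrow> nat \<Rightarrow> trm list \<Rightarrow> trm \<Rightarrow> trm \<Rightarrow> bool" where
  "infer S 0 \<Gamma> t = None"
| "infer S (Suc k) \<Gamma> t = (case t of
      Var n \<Rightarrow> if n < length \<Gamma> then Some ((lift 0 ^^ Suc n) (\<Gamma> ! n)) else None
    | U i \<Rightarrow> Some (U (Suc i))
    | Pi A B \<Rightarrow>
        (case infer S k \<Gamma> A of
          Some (U i) \<Rightarrow>
            (case infer S k (A # \<Gamma>) B of Some (U j) \<Rightarrow> Some (U (max i j)) | _ \<Rightarrow> None)
        | _ \<Rightarrow> None)
    | Lam b \<Rightarrow> None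
    | Const c \<Rightarrow> if c \<in> set S then Some (closed (ctype c 0 0)) else None
    | App f a \<Rightarrow>
        (case f of
          Lam b \<Rightarrow>
            (case infer S k \<Gamma> a of
              Some A \<Rightarrow> (case infer S k (A # \<Gamma>) b of Some B \<Rightarrow> Some (subst 0 a B) | None \<Rightarrow> None)
            | None \<Rightarrow> None)
        | _ \<Rightarrow>
            (case infer S k \<Gamma> f of
              Some T \<Rightarrow>
                (case expose S k \<Gamma> T of
                  Some (A, B) \<Rightarrow> if check S k \<Gamma> a A then Some (subst 0 a B) else None
                | None \<Rightarrow> None)
            | None \<Rightarrow> None)))"
| "expose S 0 \<Gamma> T = None"
| "expose S (Suc k) \<Gamma> T = (case T of
      Pi A B \<Rightarrow> Some (A, B)
    | _ \<Rightarrow>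
        (case norm k T of
          Pi A B \<Rightarrow> (case infer S k \<Gamma> (Pi A B) of Some (U i) \<Rightarrow> Some (A, B) | _ \<Rightarrow> None)
        | _ \<Rightarrow> None))"
| "check S 0 \<Gamma> t T \<longleftrightarrow> False"
| "check S (Suc k) \<Gamma> t T \<longleftrightarrow> (case t of
      Lam b \<Rightarrow>
        (case expose S k \<Gamma> T of Some (A, B) \<Rightarrow> check S k (A # \<Gamma>) b B | None \<Rightarrow> False)
    | _ \<Rightarrow> (case infer S k \<Gamma> t of Some T' \<Rightarrow> convertible k T' T | None \<Rightarrow> False))"

lemma strip_foldl: "strip t as = (h, bs) \<Longrightarrow> foldl App t as = foldl App h bs"
  by (induction t as rule: strip.induct) auto

lemma strip_Nil: "strip t [] = (h, bs) \<Longrightarrow> t = foldl App h bs"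
  using strip_foldl[of t "[]"] by simp

lemma conv_iota: "iota c ts = Some t \<Longrightarrow> capp c ts \<down> t"
  unfolding iota_def
  by (auto split: list.splits prod.splits if_splits dest!: strip_Nil
      intro: conv_Refl[unfolded capp_def, simplified] conv_Pair[unfolded capp_def, simplified] conv_PTr[unfolded capp_def, simplified]
        conv_STr[unfolded capp_def, simplified] conv_Cls[unfolded capp_def, simplified] simp: capp_def)

lemma conv_contract: "t \<down> contract t"
proof -
  have "t \<down> (case strip t [] of
        (Const c, ts) \<Rightarrow> (case iota c ts of Some t' \<Rightarrow> t' | None \<Rightarrow> t)
      | _ \<Rightarrow> t)"
    using conv_iota strip_Nil[of t]
    by (auto split: prod.split trm.split option.split intro: conv_refl simp: capp_def)
  then show ?thesis
    unfolding contract_def by (auto split: trm.split intro: conv_beta)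
qed

lemma conv_reduce: "t \<down> reduce t"
  by (induction t)
     (auto intro: conv_refl conv_Pi conv_Lam conv_App conv_trans[OF conv_App conv_contract])

lemma conv_norm: "t \<down> norm k t"
  by (induction k arbitrary: t) (auto simp: Let_def intro: conv_refl conv_trans[OF conv_reduce])

lemma conv_convertible: "convertible k s t \<Longrightarrow> s \<down> t"
proof (induction k arbitrary: s t)
  case 0 then show ?case by (auto intro: conv_refl)
next
  case (Suc k)
  have "s \<down> t" if "convertible k (reduce s) (reduce t)"
    using conv_trans[OF conv_reduce conv_trans[OF Suc.IH[OF that] conv_sym[OF conv_reduce]]] .
  with Suc show ?case
    by (auto split: if_splits trm.splits intro: conv_refl conv_Pi conv_Lam conv_App)
qed

definition sound_constants :: "const list \<Rightarrow> bool" where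
  "sound_constants S \<longleftrightarrow> (\<forall>c \<in> set S. \<exists>i. [] \<turnstile> closed (ctype c 0 0) : U i)"

text \<open>
  Apart from soundness, the invariant is that inferred types are well formed. It is what the conversion
  rule asks for when an argument is checked against the domain of a function; it is preserved by
  application because of inversion for products and the substitution lemma.
\<close>

lemma checker_sound:
  assumes S: "sound_constants S"
  shows "(ctx \<Gamma> \<longrightarrow> infer S k \<Gamma> t = Some T \<longrightarrow> \<Gamma> \<turnstile> t : T \<and> (\<exists>i. \<Gamma> \<turnstile> T : U i))
       \<and> (\<Gamma> \<turnstile> T : U j \<longrightarrow> expose S k \<Gamma> T = Some (A, B) \<longrightarrow> T \<down> Pi A B \<and> (\<exists>i. \<Gamma> \<turnstile> Pi A B : U i))
       \<and> (\<Gamma> \<turnstile> T : U j \<longrightarrow> check S k \<Gamma> t T \<longrightarrow> \<Gamma> \<turnstile> t : T)"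
proof (induction k arbitrary: \<Gamma> t T A B j)
  case 0 then show ?case by simp
next
  case (Suc k)
  have inf: "\<Gamma> \<turnstile> t : T \<and> (\<exists>i. \<Gamma> \<turnstile> T : U i)" if "ctx \<Gamma>" "infer S k \<Gamma> t = Some T" for \<Gamma> t T
    using Suc.IH that by blast
  have exp: "T \<down> Pi A B \<and> (\<exists>i. \<Gamma> \<turnstile> Pi A B : U i)"
    if "\<Gamma> \<turnstile> T : U j" "expose S k \<Gamma> T = Some (A, B)" for \<Gamma> T A B j
    using Suc.IH that by blast
  have chk: "\<Gamma> \<turnstile> t : T" if "\<Gamma> \<turnstile> T : U j" "check S k \<Gamma> t T" for \<Gamma> t T j
    using Suc.IH that by blast
  have "\<Gamma> \<turnstile> t : T \<and> (\<exists>i. \<Gamma> \<turnstile> T : U i)" if ctx: "ctx \<Gamma>" and t: "infer S (Suc k) \<Gamma> t = Some T"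
  proof (cases t)
    case (Var n)
    with t have n: "n < length \<Gamma>" and T: "T = (lift 0 ^^ Suc n) (\<Gamma> ! n)"
      by (auto split: if_splits)
    have "\<exists>i. \<Gamma> \<turnstile> (lift 0 ^^ Suc n) (\<Gamma> ! n) : U i"
      using ctx n
    proof (induction \<Gamma> arbitrary: n rule: list.induct)
      case (Cons B \<Gamma>)
      then obtain i where B: "\<Gamma> \<turnstile> B : U i" "ctx \<Gamma>" by (blast elim: ctx_ConsD)
      have "\<exists>i. \<Gamma> \<turnstile> (lift 0 ^^ n) ((B # \<Gamma>) ! n) : U i"
      proof (cases n)
        case 0 with B show ?thesis by auto
      next
        case (Suc m) with Cons B show ?thesis by auto
      qed
      then show ?case using weakening[OF _ Cons.prems(1)] by fastforce
    qed simp
    with ty_Var[OF ctx n] T Var show ?thesis by simp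
  next
    case (U i)
    with t ctx show ?thesis by (auto intro: ty_U)
  next
    case (Pi A B)
    with t obtain i j where A: "infer S k \<Gamma> A = Some (U i)" and B: "infer S k (A # \<Gamma>) B = Some (U j)"
      and T: "T = U (max i j)" by (auto split: option.splits trm.splits)
    from inf[OF ctx A] have A': "\<Gamma> \<turnstile> A : U i" by simp
    from inf[OF ctx_Cons[OF A' ctx] B] have "A # \<Gamma> \<turnstile> B : U j" by simp
    with A' have "\<Gamma> \<turnstile> Pi A B : U (max i j)" by (auto intro!: ty_Pi elim: cumul_le)
    with T Pi ctx show ?thesis by (auto intro: ty_U)
  next
    case (Lam b) with t show ?thesis by simp
  next
    case (Const c)
    with t have c: "c \<in> set S" and T: "T = closed (ctype c 0 0)" by (auto split: if_splits)
    with S obtain i where "[] \<turnstile> T : U i" by (auto simp: sound_constants_def)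
    then have "\<Gamma> \<turnstile> T : U i" using weakening_closed[OF _ _ _ ctx] fv_below_ctype T by simp
    with T Const ctx show ?thesis by (auto intro: ty_Const)
  next
    case (App f a)
    show ?thesis
    proof (cases "\<exists>b. f = Lam b")
      case True
      then obtain b where f: "f = Lam b" by blast
      with t App obtain A B where a: "infer S k \<Gamma> a = Some A" and b: "infer S k (A # \<Gamma>) b = Some B"
        and T: "T = subst 0 a B" by (auto split: option.splits)
      from inf[OF ctx a] obtain i where A: "\<Gamma> \<turnstile> a : A" "\<Gamma> \<turnstile> A : U i" by blast
      from inf[OF ctx_Cons[OF A(2) ctx] b] obtain j where "A # \<Gamma> \<turnstile> b : B" "A # \<Gamma> \<turnstile> B : U j"
        by blast
      with A substitution[OF this(2) A(1)] show ?thesis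
        unfolding App f T by (auto intro: ty_App ty_Lam)
    next
      case False
      with t App obtain F A B where f: "infer S k \<Gamma> f = Some F" and F: "expose S k \<Gamma> F = Some (A, B)"
        and a: "check S k \<Gamma> a A" and T: "T = subst 0 a B"
        by (auto split: option.splits trm.splits if_splits)
      from inf[OF ctx f] obtain i where f': "\<Gamma> \<turnstile> f : F" "\<Gamma> \<turnstile> F : U i" by blast
      from exp[OF f'(2) F] obtain j where P: "F \<down> Pi A B" "\<Gamma> \<turnstile> Pi A B : U j" by blast
      from P(2) obtain l where AB: "\<Gamma> \<turnstile> A : U l" "A # \<Gamma> \<turnstile> B : U l" by (rule Pi_inversion)
      from chk[OF AB(1) a] have a': "\<Gamma> \<turnstile> a : A" .
      from substitution[OF AB(2) a'] ty_App[OF ty_conv[OF f'(1) P(2,1)] a']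
      show ?thesis unfolding App T by auto
    qed
  qed
  moreover have "T \<down> Pi A B \<and> (\<exists>i. \<Gamma> \<turnstile> Pi A B : U i)"
    if T: "\<Gamma> \<turnstile> T : U j" and e: "expose S (Suc k) \<Gamma> T = Some (A, B)"
  proof (cases "\<exists>A B. T = Pi A B")
    case True with T e show ?thesis by (auto intro: conv_refl)
  next
    case False
    with e obtain i where "norm k T = Pi A B" "infer S k \<Gamma> (Pi A B) = Some (U i)"
      by (auto split: trm.splits option.splits)
    then show ?thesis using conv_norm[of T k] inf[OF ctx_of_typing[OF T]] by auto
  qed
  moreover have "\<Gamma> \<turnstile> t : T" if T: "\<Gamma> \<turnstile> T : U j" and c: "check S (Suc k) \<Gamma> t T"
  proof (cases "\<exists>b. t = Lam b")
    case True
    then obtain b where t: "t = Lam b" by blast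
    with c obtain A B where e: "expose S k \<Gamma> T = Some (A, B)" and b: "check S k (A # \<Gamma>) b B"
      by (auto split: option.splits)
    from exp[OF T e] obtain i where P: "T \<down> Pi A B" "\<Gamma> \<turnstile> Pi A B : U i" by blast
    from P(2) obtain l where "A # \<Gamma> \<turnstile> B : U l" by (rule Pi_inversion)
    from ty_Lam[OF chk[OF this b]] show ?thesis
      unfolding t by (rule ty_conv[OF _ T conv_sym[OF P(1)]])
  next
    case False
    with c obtain T' where "infer S k \<Gamma> t = Some T'" "convertible k T' T"
      by (auto split: trm.splits option.splits)
    with inf[OF ctx_of_typing[OF T]] show ?thesis
      using ty_conv[OF _ T conv_convertible] by blast
  qed
  ultimately show ?case by blast
qed

lemma sound_constants_Nil: "sound_constants []"
  by (simp add: sound_constants_def)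

lemma sound_constants_Cons:
  assumes "sound_constants S" "infer S k [] (closed (ctype c 0 0)) = Some (U i)"
  shows "sound_constants (c # S)"
proof -
  have "[] \<turnstile> closed (ctype c 0 0) : U i"
    using checker_sound[OF assms(1)] assms(2) ctx_Nil by blast
  with assms(1) show ?thesis by (auto simp: sound_constants_def)
qed

text \<open>The type of a constant may mention the constants that follow it in the list.\<close>

primrec type_constants :: "const list \<Rightarrow> bool" where
  "type_constants [] = True"
| "type_constants (c # S) \<longleftrightarrow>
    type_constants S \<and> (case infer S 40 [] (closed (ctype c 0 0)) of Some (U i) \<Rightarrow> True | _ \<Rightarrow> False)"

lemma type_constants_sound: "type_constants S \<Longrightarrow> sound_constants S"
  by (induction S)
     (auto simp: sound_constants_Nil split: option.splits trm.splits intro: sound_constants_Cons)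

section \<open>Proving a type from earlier results\<close>

definition hott_constants :: "const list" where
  "hott_constants = [CQuotInd, CQuotSet, CClsEq, CCls, CQuot, CSTrInd, CSTrSet, CSTr, CSTrunc,
    CPTrInd, CPTrEq, CPTr, CPTrunc, CSigmaInd, CPair, CSigma, CIdInd, CRefl, CId]"

lemma sound_hott_constants: "sound_constants hott_constants"
  by (rule type_constants_sound) code_simp

text \<open>
  The term \<open>t\<close> is a function from proofs of the closed types \<open>Hs\<close> to proofs of \<open>T\<close>. As all of them are
  closed, the iterated product needs no lifting.
\<close>

definition certifies :: "trm \<Rightarrow> trm list \<Rightarrow> trm \<Rightarrow> bool" where
  "certifies t Hs T \<longleftrightarrow> list_all (fv_below 0) Hs \<and> fv_below 0 T \<and>
    (case infer hott_constants 70 [] T of Some (U i) \<Rightarrow> True | _ \<Rightarrow> False) \<and>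
    check hott_constants 70 [] t (foldr Pi Hs T)"

lemma fv_below_mono: "fv_below k t \<Longrightarrow> k \<le> l \<Longrightarrow> fv_below l t"
  by (induction t arbitrary: k l) auto

lemma fv_below_foldr_Pi:
  "list_all (fv_below 0) Hs \<Longrightarrow> fv_below 0 T \<Longrightarrow> fv_below 0 (foldr Pi Hs T)"
  by (induction Hs) (auto intro: fv_below_mono)

lemma typing_foldr_Pi:
  assumes "list_all (\<lambda>H. fv_below 0 H \<and> (\<exists>i. [] \<turnstile> H : U i)) Hs" "fv_below 0 T" "[] \<turnstile> T : U j"
  shows "\<exists>k. [] \<turnstile> foldr Pi Hs T : U k"
  using assms(1)
proof (induction Hs)
  case Nil then show ?case using assms(3) by auto
next
  case (Cons H Hs)
  then obtain i k where H: "[] \<turnstile> H : U i" and P: "[] \<turnstile> foldr Pi Hs T : U k" by auto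
  have "fv_below 0 (foldr Pi Hs T)"
    using Cons.prems assms(2) by (intro fv_below_foldr_Pi) (auto simp: list_all_iff)
  then have "[H] \<turnstile> foldr Pi Hs T : U k"
    using weakening_closed[OF P] ctx_Cons[OF H ctx_Nil] by simp
  then have "[] \<turnstile> Pi H (foldr Pi Hs T) : U (max i k)"
    using H by (auto intro!: ty_Pi elim: cumul_le)
  then show ?case by auto
qed

lemma provable_of_foldr_Pi:
  assumes "list_all (\<lambda>H. fv_below 0 H \<and> (\<exists>h. [] \<turnstile> h : H)) Hs" "fv_below 0 T"
    and "[] \<turnstile> t : foldr Pi Hs T"
  shows "\<exists>t. [] \<turnstile> t : T"
  using assms(1,3)
proof (induction Hs arbitrary: t)
  case Nil then show ?case by auto
next
  case (Cons H Hs)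
  then obtain h where h: "[] \<turnstile> h : H" by auto
  have "fv_below 0 (foldr Pi Hs T)"
    using Cons.prems(1) assms(2) by (intro fv_below_foldr_Pi) (auto simp: list_all_iff)
  then have "subst 0 h (foldr Pi Hs T) = foldr Pi Hs T"
    by (simp add: subst_eq_psubst psubst_closed)
  with ty_App[OF _ h, of t "foldr Pi Hs T"] Cons.prems show ?case
    using Cons.IH by simp
qed

text \<open>
  The types \<open>Hs\<close> are well formed because they are provable, so only \<open>T\<close> and \<open>t\<close> have to be
  checked. Evaluating the premise on concrete terms is the type checking of a proof.
\<close>

lemma provable_by:
  assumes "certifies (closed t) (map closed Hs) (closed T)" "list_all provable Hs"
  shows "provable T"
proof -
  let ?P = "foldr Pi (map closed Hs) (closed T)"
  from assms(1) obtain i where i: "infer hott_constants 70 [] (closed T) = Some (U i)"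
    and t: "check hott_constants 70 [] (closed t) ?P"
    and fv: "list_all (fv_below 0) (map closed Hs)" "fv_below 0 (closed T)"
    by (auto simp: certifies_def split: option.splits trm.splits)
  note sound = checker_sound[OF sound_hott_constants]
  from sound i ctx_Nil have T: "[] \<turnstile> closed T : U i" by blast
  with fv assms(2) obtain j where "[] \<turnstile> ?P : U j"
    using typing_foldr_Pi[of "map closed Hs" "closed T" i] by (auto simp: list_all_iff provable_def)
  with sound t have "[] \<turnstile> closed t : ?P" by blast
  with fv assms(2) have "\<exists>t. [] \<turnstile> t : closed T"
    by (intro provable_of_foldr_Pi) (auto simp: list_all_iff provable_def)
  with T show ?thesis by (auto simp: provable_def)
qed

section \<open>Paths, propositions and sets\<close>

definition path_ind :: "expr \<Rightarrow> (expr \<Rightarrow> expr \<Rightarrow> expr \<Rightarrow> expr) \<Rightarrow> (expr \<Rightarrow> expr) \<Rightarrow> expr \<Rightarrow> expr \<Rightarrow> expr \<Rightarrow> expr" where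
  "path_ind A C d x y p = cst CIdInd [A, \<^bold>\<lambda>x y p. C x y p, \<^bold>\<lambda>x. d x, x, y, p]"

definition sigma_ind :: "expr \<Rightarrow> (expr \<Rightarrow> expr) \<Rightarrow> (expr \<Rightarrow> expr) \<Rightarrow> (expr \<Rightarrow> expr \<Rightarrow> expr) \<Rightarrow> expr \<Rightarrow> expr" where
  "sigma_ind A B C d s = cst CSigmaInd [A, \<^bold>\<lambda>a. B a, \<^bold>\<lambda>s. C s, \<^bold>\<lambda>a b. d a b, s]"

definition pr2 :: "expr \<Rightarrow> (expr \<Rightarrow> expr) \<Rightarrow> expr \<Rightarrow> expr" where
  "pr2 A B s = sigma_ind A B (\<lambda>s. B (pr1 A B s)) (\<lambda>a b. b) s"

definition ptr :: "expr \<Rightarrow> expr \<Rightarrow> expr" where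
  "ptr A a = cst CPTr [A, a]"

definition ptr_rec :: "expr \<Rightarrow> expr \<Rightarrow> expr \<Rightarrow> (expr \<Rightarrow> expr) \<Rightarrow> expr \<Rightarrow> expr" where
  "ptr_rec A C h d x = cst CPTrInd [A, \<^bold>\<lambda>_. C, \<^bold>\<lambda>_. h, \<^bold>\<lambda>a. d a, x]"

definition str_set :: "expr \<Rightarrow> expr" where
  "str_set A = cst CSTrSet [A]"

definition str_rec :: "expr \<Rightarrow> expr \<Rightarrow> expr \<Rightarrow> (expr \<Rightarrow> expr) \<Rightarrow> expr \<Rightarrow> expr" where
  "str_rec A C h d x = cst CSTrInd [A, \<^bold>\<lambda>_. C, \<^bold>\<lambda>_. h, \<^bold>\<lambda>a. d a, x]"

definition Path_sym :: expr where
  "Path_sym = (\<^bold>\<Pi>A : univ 0. \<^bold>\<Pi>x : A. \<^bold>\<Pi>y : A. eq A x y \<^bold>\<rightarrow> eq A y x)"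

lemma Path_sym: "provable Path_sym"
  by (rule provable_by[where Hs = "[]" and t = "
    \<^bold>\<lambda>A x y p. path_ind A (\<lambda>x y p. eq A y x) (\<lambda>x. rfl A x) x y p"]) (code_simp, simp)

definition Path_trans :: expr where
  "Path_trans = (\<^bold>\<Pi>A : univ 0. \<^bold>\<Pi>x : A. \<^bold>\<Pi>y : A. \<^bold>\<Pi>z : A. eq A x y \<^bold>\<rightarrow> eq A y z \<^bold>\<rightarrow> eq A x z)"

lemma Path_trans: "provable Path_trans"
  by (rule provable_by[where Hs = "[]" and t = "
    \<^bold>\<lambda>A x y z p q. transport A (\<^bold>\<lambda>w. eq A x w) y z q \<cdot> p"]) (code_simp, simp)

definition Path_ap :: expr where
  "Path_ap = (\<^bold>\<Pi>A : univ 0. \<^bold>\<Pi>B : univ 0. \<^bold>\<Pi>f : A \<^bold>\<rightarrow> B. \<^bold>\<Pi>x : A. \<^bold>\<Pi>y : A.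
    eq A x y \<^bold>\<rightarrow> eq B (f \<cdot> x) (f \<cdot> y))"

lemma Path_ap: "provable Path_ap"
  by (rule provable_by[where Hs = "[]" and t = "
    \<^bold>\<lambda>A B f x y p. path_ind A (\<lambda>x y p. eq B (f \<cdot> x) (f \<cdot> y)) (\<lambda>x. rfl B (f \<cdot> x)) x y p"])
    (code_simp, simp)

definition Transport_const :: expr where
  "Transport_const = (\<^bold>\<Pi>A : univ 0. \<^bold>\<Pi>B : univ 0. \<^bold>\<Pi>x : A. \<^bold>\<Pi>y : A. \<^bold>\<Pi>p : eq A x y. \<^bold>\<Pi>b : B.
    eq B (transport A (\<^bold>\<lambda>_. B) x y p \<cdot> b) b)"

lemma Transport_const: "provable Transport_const"
  by (rule provable_by[where Hs = "[]" and t = "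
    \<^bold>\<lambda>A B x y p. path_ind A
      (\<lambda>x y p. \<^bold>\<Pi>b : B. eq B (transport A (\<^bold>\<lambda>_. B) x y p \<cdot> b) b) (\<lambda>x. \<^bold>\<lambda>b. rfl B b) x y p"])
    (code_simp, simp)

text \<open>The composite \<open>p\<inverse> q\<close>, which computes when \<open>p\<close> is reflexivity.\<close>

definition path_divide :: "expr \<Rightarrow> expr \<Rightarrow> expr \<Rightarrow> expr \<Rightarrow> expr \<Rightarrow> expr \<Rightarrow> expr" where
  "path_divide A x x' y p q = transport A (\<^bold>\<lambda>w. eq A w y) x x' p \<cdot> q"

definition Path_divide_self :: expr where
  "Path_divide_self = (\<^bold>\<Pi>A : univ 0. \<^bold>\<Pi>x : A. \<^bold>\<Pi>y : A. \<^bold>\<Pi>p : eq A x y.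
    eq (eq A y y) (path_divide A x y y p p) (rfl A y))"

lemma Path_divide_self: "provable Path_divide_self"
  by (rule provable_by[where Hs = "[]" and t = "
    \<^bold>\<lambda>A x y p. path_ind A (\<lambda>x y p. eq (eq A y y) (path_divide A x y y p p) (rfl A y))
      (\<lambda>x. rfl (eq A x x) (rfl A x)) x y p"]) (code_simp, simp)

definition Prop_is_set :: expr where
  "Prop_is_set = (\<^bold>\<Pi>A : univ 0. isProp A \<^bold>\<rightarrow> isSet A)"

text \<open>
  Let \<open>h\<close> witness that \<open>A\<close> is a proposition and put \<open>m x y = (h x x)\<inverse> (h x y)\<close>. Every path \<open>p : x = y\<close> equals
  \<open>m x y\<close>, by induction on \<open>p\<close>; since \<open>m x y\<close> does not mention \<open>p\<close>, any two paths are equal.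
\<close>

lemma Prop_is_set: "provable Prop_is_set"
  by (rule provable_by[where Hs = "[Path_sym, Path_trans, Path_divide_self]" and t = "
    \<^bold>\<lambda>sym trans divideSelf A h x y p q.
      (let m = (\<lambda>x y. path_divide A x x y (h \<cdot> x \<cdot> x) (h \<cdot> x \<cdot> y));
           c = (\<lambda>p. path_ind A (\<lambda>x y p. eq (eq A x y) (m x y) p)
                 (\<lambda>x. divideSelf \<cdot> A \<cdot> x \<cdot> x \<cdot> (h \<cdot> x \<cdot> x)) x y p)
       in trans \<cdot> eq A x y \<cdot> p \<cdot> m x y \<cdot> q \<cdot> (sym \<cdot> eq A x y \<cdot> m x y \<cdot> p \<cdot> c p) \<cdot> c q)"])
    (code_simp, simp add: Path_sym Path_trans Path_divide_self)

text \<open>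
  Into families of propositions one can eliminate knowing only the values on constructors: propositions
  are sets, and for quotients the coherence condition is an equation in a proposition.
\<close>

definition STrunc_prop_ind :: expr where
  "STrunc_prop_ind = (\<^bold>\<Pi>A : univ 0. \<^bold>\<Pi>C : (STrunc A \<^bold>\<rightarrow> univ 0). (\<^bold>\<Pi>x : STrunc A. isProp (C \<cdot> x)) \<^bold>\<rightarrow>
    (\<^bold>\<Pi>a : A. C \<cdot> str A a) \<^bold>\<rightarrow> (\<^bold>\<Pi>x : STrunc A. C \<cdot> x))"

lemma STrunc_prop_ind: "provable STrunc_prop_ind"
  by (rule provable_by[where Hs = "[Prop_is_set]" and t = "
    \<^bold>\<lambda>propSet A C h d x. cst CSTrInd [A, C, \<^bold>\<lambda>y. propSet \<cdot> (C \<cdot> y) \<cdot> (h \<cdot> y), d, x]"])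
    (code_simp, simp add: Prop_is_set)

definition Quot_prop_ind :: expr where
  "Quot_prop_ind = (\<^bold>\<Pi>A : univ 0. \<^bold>\<Pi>R : (A \<^bold>\<rightarrow> A \<^bold>\<rightarrow> univ 0). \<^bold>\<Pi>C : (cst CQuot [A, R] \<^bold>\<rightarrow> univ 0).
    (\<^bold>\<Pi>x : cst CQuot [A, R]. isProp (C \<cdot> x)) \<^bold>\<rightarrow> (\<^bold>\<Pi>a : A. C \<cdot> cst CCls [A, R, a]) \<^bold>\<rightarrow>
    (\<^bold>\<Pi>x : cst CQuot [A, R]. C \<cdot> x))"

lemma Quot_prop_ind: "provable Quot_prop_ind"
  by (rule provable_by[where Hs = "[Prop_is_set]" and t = "
    \<^bold>\<lambda>propSet A R C h d x. cst CQuotInd [A, R, C, \<^bold>\<lambda>y. propSet \<cdot> (C \<cdot> y) \<cdot> (h \<cdot> y), d,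
      \<^bold>\<lambda>a b r. h \<cdot> cst CCls [A, R, b]
        \<cdot> (transport (cst CQuot [A, R]) C (cst CCls [A, R, a]) (cst CCls [A, R, b])
             (cst CClsEq [A, R, a, b, r]) \<cdot> (d \<cdot> a))
        \<cdot> (d \<cdot> b), x]"])
    (code_simp, simp add: Prop_is_set)

text \<open>
  The computation rule is stated along an arbitrary \<open>s : P \<rightarrow> A\<close>, because the map on orbits is to be
  described on the orbits of truncated pointed maps \<open>|g|\<close> only.
\<close>

definition Quot_rec :: expr where
  "Quot_rec = (\<^bold>\<Pi>A : univ 0. \<^bold>\<Pi>R : (A \<^bold>\<rightarrow> A \<^bold>\<rightarrow> univ 0). \<^bold>\<Pi>N : univ 0. isSet N \<^bold>\<rightarrow> (\<^bold>\<Pi>f : A \<^bold>\<rightarrow> N.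
    (\<^bold>\<Pi>a : A. \<^bold>\<Pi>b : A. R \<cdot> a \<cdot> b \<^bold>\<rightarrow> eq N (f \<cdot> a) (f \<cdot> b)) \<^bold>\<rightarrow> (\<^bold>\<Pi>P : univ 0. \<^bold>\<Pi>s : P \<^bold>\<rightarrow> A.
    (\<^bold>\<Sigma>F : cst CQuot [A, R] \<^bold>\<rightarrow> N. \<^bold>\<Pi>p : P. eq N (F \<cdot> cst CCls [A, R, s \<cdot> p]) (f \<cdot> (s \<cdot> p))))))"

lemma Quot_rec: "provable Quot_rec"
  by (rule provable_by[where Hs = "[Path_trans, Transport_const]" and t = "
    \<^bold>\<lambda>trans transportConst A R N set f e P s.
      (let Q = cst CQuot [A, R]; c = (\<lambda>a. cst CCls [A, R, a]) in
       pair (Q \<^bold>\<rightarrow> N) (\<lambda>F. \<^bold>\<Pi>p : P. eq N (F \<cdot> c (s \<cdot> p)) (f \<cdot> (s \<cdot> p)))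
         (\<^bold>\<lambda>q. cst CQuotInd [A, R, \<^bold>\<lambda>_. N, \<^bold>\<lambda>_. set, f,
           \<^bold>\<lambda>a b r. let m = cst CClsEq [A, R, a, b, r] in
             trans \<cdot> N \<cdot> (transport Q (\<^bold>\<lambda>_. N) (c a) (c b) m \<cdot> (f \<cdot> a)) \<cdot> (f \<cdot> a) \<cdot> (f \<cdot> b)
             \<cdot> (transportConst \<cdot> Q \<cdot> N \<cdot> c a \<cdot> c b \<cdot> m \<cdot> (f \<cdot> a)) \<cdot> (e \<cdot> a \<cdot> b \<cdot> r), q])
         (\<^bold>\<lambda>p. rfl N (f \<cdot> (s \<cdot> p))))"])
    (code_simp, simp add: Path_trans Transport_const)

text \<open>
  Here \<open>a l\<close> stands for the translate of \<open>g\<close> by \<open>l\<close>. That \<open>h\<close> is a translate of \<open>g\<close> is only known up to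
  truncation, which can be eliminated because the conclusion is an equation in a set.
\<close>

definition Orbit_constant :: expr where
  "Orbit_constant = (\<^bold>\<Pi>M : univ 0. \<^bold>\<Pi>N : univ 0. isSet N \<^bold>\<rightarrow> (\<^bold>\<Pi>F : M \<^bold>\<rightarrow> N. \<^bold>\<Pi>L : univ 0. \<^bold>\<Pi>a : L \<^bold>\<rightarrow> M.
    \<^bold>\<Pi>g : M. \<^bold>\<Pi>h : M. (\<^bold>\<Pi>l : L. eq N (F \<cdot> (a \<cdot> l)) (F \<cdot> g)) \<^bold>\<rightarrow>
    PTrunc (\<^bold>\<Sigma>l : L. eq M (a \<cdot> l) h) \<^bold>\<rightarrow> eq N (F \<cdot> g) (F \<cdot> h)))"

lemma Orbit_constant: "provable Orbit_constant"
  by (rule provable_by[where Hs = "[Path_sym, Path_trans, Path_ap]" and t = "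
    \<^bold>\<lambda>sym trans ap M N set F L a g h e r.
      (let E = eq N (F \<cdot> g) (F \<cdot> h) in
       ptr_rec (\<^bold>\<Sigma>l : L. eq M (a \<cdot> l) h) E (set \<cdot> (F \<cdot> g) \<cdot> (F \<cdot> h))
         (\<lambda>s. sigma_ind L (\<lambda>l. eq M (a \<cdot> l) h) (\<lambda>_. E)
           (\<lambda>l q. trans \<cdot> N \<cdot> (F \<cdot> g) \<cdot> (F \<cdot> (a \<cdot> l)) \<cdot> (F \<cdot> h)
             \<cdot> (sym \<cdot> N \<cdot> (F \<cdot> (a \<cdot> l)) \<cdot> (F \<cdot> g) \<cdot> (e \<cdot> l))
             \<cdot> (ap \<cdot> M \<cdot> N \<cdot> F \<cdot> (a \<cdot> l) \<cdot> h \<cdot> q)) s) r)"])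
    (code_simp, simp add: Path_sym Path_trans Path_ap)

definition Sigma_refine :: expr where
  "Sigma_refine = (\<^bold>\<Pi>A : univ 0. \<^bold>\<Pi>B : (A \<^bold>\<rightarrow> univ 0). \<^bold>\<Pi>C : (A \<^bold>\<rightarrow> univ 0).
    (\<^bold>\<Sigma>a : A. B \<cdot> a) \<^bold>\<rightarrow> (\<^bold>\<Pi>a : A. B \<cdot> a \<^bold>\<rightarrow> C \<cdot> a) \<^bold>\<rightarrow> (\<^bold>\<Sigma>a : A. B \<cdot> a \<^bold>\<times> C \<cdot> a))"

lemma Sigma_refine: "provable Sigma_refine"
  by (rule provable_by[where Hs = "[]" and t = "
    \<^bold>\<lambda>A B C s h. sigma_ind A (\<lambda>a. B \<cdot> a) (\<lambda>_. \<^bold>\<Sigma>a : A. B \<cdot> a \<^bold>\<times> C \<cdot> a)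
      (\<lambda>a b. pair A (\<lambda>a. B \<cdot> a \<^bold>\<times> C \<cdot> a) a (pair (B \<cdot> a) (\<lambda>_. C \<cdot> a) b (h \<cdot> a \<cdot> b))) s"])
    (code_simp, simp)

definition Sigma_path :: expr where
  "Sigma_path = (\<^bold>\<Pi>A : univ 0. \<^bold>\<Pi>B : (A \<^bold>\<rightarrow> univ 0). (\<^bold>\<Pi>a : A. isProp (B \<cdot> a)) \<^bold>\<rightarrow>
    (\<^bold>\<Pi>a : A. \<^bold>\<Pi>a' : A. \<^bold>\<Pi>p : eq A a a'. \<^bold>\<Pi>b : B \<cdot> a. \<^bold>\<Pi>b' : B \<cdot> a'.
      eq (\<^bold>\<Sigma>a : A. B \<cdot> a) (pair A (\<lambda>a. B \<cdot> a) a b) (pair A (\<lambda>a. B \<cdot> a) a' b')))"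

lemma Sigma_path: "provable Sigma_path"
  by (rule provable_by[where Hs = "[Path_ap]" and t = "
    \<^bold>\<lambda>ap A B h a a' p. path_ind A
      (\<lambda>a a' p. \<^bold>\<Pi>b : B \<cdot> a. \<^bold>\<Pi>b' : B \<cdot> a'.
        eq (\<^bold>\<Sigma>a : A. B \<cdot> a) (pair A (\<lambda>a. B \<cdot> a) a b) (pair A (\<lambda>a. B \<cdot> a) a' b'))
      (\<lambda>a. \<^bold>\<lambda>b b'. ap \<cdot> (B \<cdot> a) \<cdot> (\<^bold>\<Sigma>a : A. B \<cdot> a) \<cdot> (\<^bold>\<lambda>b. pair A (\<lambda>a. B \<cdot> a) a b) \<cdot> b \<cdot> b'
        \<cdot> (h \<cdot> a \<cdot> b \<cdot> b')) a a' p"])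
    (code_simp, simp add: Path_ap)

definition Sigma_prop :: expr where
  "Sigma_prop = (\<^bold>\<Pi>A : univ 0. \<^bold>\<Pi>B : (A \<^bold>\<rightarrow> univ 0). (\<^bold>\<Pi>a : A. isProp (B \<cdot> a)) \<^bold>\<rightarrow>
    (\<^bold>\<Pi>a : A. \<^bold>\<Pi>a' : A. B \<cdot> a \<^bold>\<rightarrow> B \<cdot> a' \<^bold>\<rightarrow> eq A a a') \<^bold>\<rightarrow> isProp (\<^bold>\<Sigma>a : A. B \<cdot> a))"

lemma Sigma_prop: "provable Sigma_prop"
  by (rule provable_by[where Hs = "[Sigma_path]" and t = "
    \<^bold>\<lambda>pairEq A B h e s t.
      sigma_ind A (\<lambda>a. B \<cdot> a) (\<lambda>s. eq (\<^bold>\<Sigma>a : A. B \<cdot> a) s t)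
        (\<lambda>a b. sigma_ind A (\<lambda>a. B \<cdot> a)
          (\<lambda>t. eq (\<^bold>\<Sigma>a : A. B \<cdot> a) (pair A (\<lambda>a. B \<cdot> a) a b) t)
          (\<lambda>a' b'. pairEq \<cdot> A \<cdot> B \<cdot> h \<cdot> a \<cdot> a' \<cdot> (e \<cdot> a \<cdot> a' \<cdot> b \<cdot> b') \<cdot> b \<cdot> b') t) s"])
    (code_simp, simp add: Sigma_path)

definition preimage :: "expr \<Rightarrow> expr \<Rightarrow> expr \<Rightarrow> expr \<Rightarrow> expr" where
  "preimage A W c a = (\<^bold>\<Sigma>w : W. eq A a (c \<cdot> w))"

text \<open>
  A function \<open>c\<close> on \<open>W\<close> whose values all agree has a value as soon as \<open>W\<close> is merely
  inhabited, provided it takes values in a set. The type of candidates \<open>a\<close>, each with a proof that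
  \<open>a\<close> is merely a value of \<open>c\<close>, is a proposition: two candidates are equal because equality in a set is a
  proposition, which allows choosing preimages of both.
\<close>

definition Unique_value :: expr where
  "Unique_value = (\<^bold>\<Pi>A : univ 0. isSet A \<^bold>\<rightarrow> (\<^bold>\<Pi>W : univ 0. \<^bold>\<Pi>c : W \<^bold>\<rightarrow> A.
    (\<^bold>\<Pi>w : W. \<^bold>\<Pi>w' : W. eq A (c \<cdot> w) (c \<cdot> w')) \<^bold>\<rightarrow> PTrunc W \<^bold>\<rightarrow>
    (\<^bold>\<Sigma>a : A. PTrunc (preimage A W c a))))"

lemma Unique_value: "provable Unique_value"
  by (rule provable_by[where Hs = "[Path_sym, Path_trans, Sigma_prop]" and t = "
    \<^bold>\<lambda>sym trans propSigma A set W c k.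
      (let V = preimage A W c; P = (\<lambda>a. PTrunc (V a)); S = (\<^bold>\<Sigma>a : A. P a) in
       \<^bold>\<lambda>w. ptr_rec W S
         (propSigma \<cdot> A \<cdot> (\<^bold>\<lambda>a. P a) \<cdot> (\<^bold>\<lambda>a. cst CPTrEq [V a])
           \<cdot> (\<^bold>\<lambda>a a' u u'. ptr_rec (V a) (eq A a a') (set \<cdot> a \<cdot> a')
               (\<lambda>v. ptr_rec (V a') (eq A a a') (set \<cdot> a \<cdot> a')
                 (\<lambda>v'. sigma_ind W (\<lambda>w. eq A a (c \<cdot> w)) (\<lambda>_. eq A a a')
                   (\<lambda>w p. sigma_ind W (\<lambda>w. eq A a' (c \<cdot> w)) (\<lambda>_. eq A a a')
                     (\<lambda>w' p'. trans \<cdot> A \<cdot> a \<cdot> (c \<cdot> w) \<cdot> a' \<cdot> p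
                       \<cdot> (trans \<cdot> A \<cdot> (c \<cdot> w) \<cdot> (c \<cdot> w') \<cdot> a' \<cdot> (k \<cdot> w \<cdot> w')
                           \<cdot> (sym \<cdot> A \<cdot> a' \<cdot> (c \<cdot> w') \<cdot> p'))) v') v) u') u))
         (\<lambda>w. pair A P (c \<cdot> w)
           (ptr (V (c \<cdot> w)) (pair W (\<lambda>w'. eq A (c \<cdot> w) (c \<cdot> w')) w (rfl A (c \<cdot> w))))) w)"])
    (code_simp, simp add: Path_sym Path_trans Sigma_prop)

section \<open>Pointings of a map differ by a loop\<close>

definition based :: "expr \<Rightarrow> expr \<Rightarrow> expr \<Rightarrow> expr \<Rightarrow> expr \<Rightarrow> expr \<Rightarrow> expr" where
  "based Z z0 X x f w =
     str (pmap Z z0 X x) (pair (Z \<^bold>\<rightarrow> X) (\<lambda>f. eq X (f \<cdot> z0) x) f w)"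

text \<open>At \<open>y = x\<close> this is the body of the action of loops.\<close>

definition move_basepoint :: "expr \<Rightarrow> expr \<Rightarrow> expr \<Rightarrow> expr \<Rightarrow> expr \<Rightarrow> expr \<Rightarrow> expr \<Rightarrow> expr" where
  "move_basepoint Z z0 X x y p g = transport X (\<^bold>\<lambda>x. STrunc (pmap Z z0 X x)) x y p \<cdot> g"

text \<open>The composite \<open>w p\<close>, in the form in which transport acts on the pointing of a map.\<close>

definition path_concat :: "expr \<Rightarrow> expr \<Rightarrow> expr \<Rightarrow> expr \<Rightarrow> expr \<Rightarrow> expr \<Rightarrow> expr" where
  "path_concat X a x y w p = transport X (\<^bold>\<lambda>v. eq X a v) x y p \<cdot> w"

text \<open>
  For reflexivity both sides are the pointed map itself by computation; the end points of \<open>p\<close> have to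
  be distinct variables for the induction.
\<close>

definition Move_point :: expr where
  "Move_point = (\<^bold>\<Pi>Z : univ 0. \<^bold>\<Pi>z0 : Z. \<^bold>\<Pi>X : univ 0. \<^bold>\<Pi>f : Z \<^bold>\<rightarrow> X. \<^bold>\<Pi>x : X. \<^bold>\<Pi>y : X.
    \<^bold>\<Pi>p : eq X x y. \<^bold>\<Pi>w : eq X (f \<cdot> z0) x.
    eq (STrunc (pmap Z z0 X y)) (move_basepoint Z z0 X x y p (based Z z0 X x f w))
      (based Z z0 X y f (path_concat X (f \<cdot> z0) x y w p)))"

lemma Move_point: "provable Move_point"
  by (rule provable_by[where Hs = "[]" and t = "
    \<^bold>\<lambda>Z z0 X f x y p. path_ind X (\<lambda>x y p. \<^bold>\<Pi>w : eq X (f \<cdot> z0) x.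
        eq (STrunc (pmap Z z0 X y)) (move_basepoint Z z0 X x y p (based Z z0 X x f w))
          (based Z z0 X y f (path_concat X (f \<cdot> z0) x y w p)))
      (\<lambda>x. \<^bold>\<lambda>w. rfl (STrunc (pmap Z z0 X x)) (based Z z0 X x f w)) x y p"])
    (code_simp, simp)

text \<open>
  The solution is \<open>w\<inverse> v\<close>. The end point of \<open>v\<close> is kept apart from that of \<open>w\<close>, so that induction on \<open>w\<close>
  applies; for reflexivity, \<open>p = v\<close> solves the equation.
\<close>

definition Path_concat_solve :: expr where
  "Path_concat_solve = (\<^bold>\<Pi>X : univ 0. \<^bold>\<Pi>a : X. \<^bold>\<Pi>x : X. \<^bold>\<Pi>w : eq X a x. \<^bold>\<Pi>y : X. \<^bold>\<Pi>v : eq X a y.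
    (\<^bold>\<Sigma>p : eq X x y. eq (eq X a y) (path_concat X a x y w p) v))"

lemma Path_concat_solve: "provable Path_concat_solve"
  by (rule provable_by[where Hs = "[]" and t = "
    \<^bold>\<lambda>X a x w. path_ind X
      (\<lambda>a x w. \<^bold>\<Pi>y : X. \<^bold>\<Pi>v : eq X a y. (\<^bold>\<Sigma>p : eq X x y. eq (eq X a y) (path_concat X a x y w p) v))
      (\<lambda>a. \<^bold>\<lambda>y v. pair (eq X a y) (\<lambda>p. eq (eq X a y) (path_concat X a a y (rfl X a) p) v) v
        (path_ind X (\<lambda>a y v. eq (eq X a y) (path_concat X a a y (rfl X a) v) v)
          (\<lambda>a. rfl (eq X a a) (rfl X a)) a y v)) a x w"])
    (code_simp, simp)

text \<open>The loop \<open>w\<inverse> v\<close> carries the pointing \<open>w\<close> of \<open>f\<close> to the pointing \<open>v\<close>.\<close>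

definition Act_transitive :: expr where
  "Act_transitive = (\<^bold>\<Pi>Z : univ 0. \<^bold>\<Pi>z0 : Z. \<^bold>\<Pi>X : univ 0. \<^bold>\<Pi>x0 : X. \<^bold>\<Pi>f : Z \<^bold>\<rightarrow> X.
    \<^bold>\<Pi>w : eq X (f \<cdot> z0) x0. \<^bold>\<Pi>v : eq X (f \<cdot> z0) x0.
    (\<^bold>\<Sigma>l : pi1 X x0. eq (STrunc (pmap Z z0 X x0))
      (act Z z0 X x0 (based Z z0 X x0 f w) l) (based Z z0 X x0 f v)))"

lemma Act_transitive: "provable Act_transitive"
  by (rule provable_by[where Hs = "[Path_trans, Path_ap, Move_point, Path_concat_solve]" and t = "
    \<^bold>\<lambda>trans ap movePoint concatSolve Z z0 X x0 f w v.
      (let M = STrunc (pmap Z z0 X x0); E = eq X (f \<cdot> z0) x0; L = eq X x0 x0;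
           P = based Z z0 X x0 f; wp = path_concat X (f \<cdot> z0) x0 x0 w;
           C = (\<lambda>l. eq M (act Z z0 X x0 (P w) l) (P v)) in
       sigma_ind L (\<lambda>p. eq E (wp p) v) (\<lambda>_. Defs.sigma (pi1 X x0) C)
         (\<lambda>p q. pair (pi1 X x0) C (str L p)
           (trans \<cdot> M \<cdot> move_basepoint Z z0 X x0 x0 p (P w) \<cdot> P (wp p) \<cdot> P v
             \<cdot> (movePoint \<cdot> Z \<cdot> z0 \<cdot> X \<cdot> f \<cdot> x0 \<cdot> x0 \<cdot> p \<cdot> w)
             \<cdot> (ap \<cdot> E \<cdot> M \<cdot> (\<^bold>\<lambda>w. P w) \<cdot> wp p \<cdot> v \<cdot> q)))
         (concatSolve \<cdot> X \<cdot> (f \<cdot> z0) \<cdot> x0 \<cdot> w \<cdot> x0 \<cdot> v))"])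
    (code_simp, simp add: Path_trans Path_ap Move_point Path_concat_solve)

definition point_orbit :: "expr \<Rightarrow> expr \<Rightarrow> expr \<Rightarrow> expr \<Rightarrow> expr \<Rightarrow> expr \<Rightarrow> expr" where
  "point_orbit Z z0 X x0 f w = orbit Z z0 X x0 (based Z z0 X x0 f w)"

definition Orbit_basing_invariant :: expr where
  "Orbit_basing_invariant = (\<^bold>\<Pi>Z : univ 0. \<^bold>\<Pi>z0 : Z. \<^bold>\<Pi>X : univ 0. \<^bold>\<Pi>x0 : X. \<^bold>\<Pi>f : Z \<^bold>\<rightarrow> X.
    \<^bold>\<Pi>w : eq X (f \<cdot> z0) x0. \<^bold>\<Pi>v : eq X (f \<cdot> z0) x0.
    eq (Orbits Z z0 X x0) (point_orbit Z z0 X x0 f w) (point_orbit Z z0 X x0 f v))"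

lemma Orbit_basing_invariant: "provable Orbit_basing_invariant"
  by (rule provable_by[where Hs = "[Act_transitive]" and t = "
    \<^bold>\<lambda>transitive Z z0 X x0 f w v.
      (let M = STrunc (pmap Z z0 X x0); P = based Z z0 X x0 f in
       cst CClsEq [M, orbitRel Z z0 X x0, P w, P v,
         ptr (\<^bold>\<Sigma>l : pi1 X x0. eq M (act Z z0 X x0 (P w) l) (P v))
           (transitive \<cdot> Z \<cdot> z0 \<cdot> X \<cdot> x0 \<cdot> f \<cdot> w \<cdot> v)])"])
    (code_simp, simp add: Act_transitive)

section \<open>Forgetting the pointing on orbits\<close>

definition free_class :: "expr \<Rightarrow> expr \<Rightarrow> expr \<Rightarrow> expr \<Rightarrow> expr \<Rightarrow> expr" where
  "free_class Z z0 X x u = str_rec (pmap Z z0 X x) (STrunc (Z \<^bold>\<rightarrow> X)) (str_set (Z \<^bold>\<rightarrow> X))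
     (\<lambda>g. str (Z \<^bold>\<rightarrow> X) (forget Z z0 X x g)) u"

text \<open>Transport along a path in \<open>X\<close> does not touch the underlying map.\<close>

definition Free_move :: expr where
  "Free_move = (\<^bold>\<Pi>Z : univ 0. \<^bold>\<Pi>z0 : Z. \<^bold>\<Pi>X : univ 0. \<^bold>\<Pi>x : X. \<^bold>\<Pi>y : X. \<^bold>\<Pi>p : eq X x y.
    \<^bold>\<Pi>u : STrunc (pmap Z z0 X x).
    eq (STrunc (Z \<^bold>\<rightarrow> X)) (free_class Z z0 X y (move_basepoint Z z0 X x y p u)) (free_class Z z0 X x u))"

lemma Free_move: "provable Free_move"
  by (rule provable_by[where Hs = "[]" and t = "
    \<^bold>\<lambda>Z z0 X x y p. path_ind X
      (\<lambda>x y p. \<^bold>\<Pi>u : STrunc (pmap Z z0 X x).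
        eq (STrunc (Z \<^bold>\<rightarrow> X)) (free_class Z z0 X y (move_basepoint Z z0 X x y p u)) (free_class Z z0 X x u))
      (\<lambda>x. \<^bold>\<lambda>u. rfl (STrunc (Z \<^bold>\<rightarrow> X)) (free_class Z z0 X x u)) x y p"])
    (code_simp, simp)

definition Free_act :: expr where
  "Free_act = (\<^bold>\<Pi>Z : univ 0. \<^bold>\<Pi>z0 : Z. \<^bold>\<Pi>X : univ 0. \<^bold>\<Pi>x0 : X.
    \<^bold>\<Pi>g : STrunc (pmap Z z0 X x0). \<^bold>\<Pi>l : pi1 X x0.
    eq (STrunc (Z \<^bold>\<rightarrow> X)) (free_class Z z0 X x0 (act Z z0 X x0 g l)) (free_class Z z0 X x0 g))"

lemma Free_act: "provable Free_act"
  by (rule provable_by[where Hs = "[STrunc_prop_ind, Free_move]" and t = "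
    \<^bold>\<lambda>strInd freeMove Z z0 X x0 g.
      (let a = act Z z0 X x0 g; F = free_class Z z0 X x0 in
       strInd \<cdot> eq X x0 x0 \<cdot> (\<^bold>\<lambda>l. eq (STrunc (Z \<^bold>\<rightarrow> X)) (F (a l)) (F g))
         \<cdot> (\<^bold>\<lambda>l. str_set (Z \<^bold>\<rightarrow> X) \<cdot> F (a l) \<cdot> F g)
         \<cdot> (\<^bold>\<lambda>p. freeMove \<cdot> Z \<cdot> z0 \<cdot> X \<cdot> x0 \<cdot> x0 \<cdot> p \<cdot> g))"])
    (code_simp, simp add: STrunc_prop_ind Free_move)

text \<open>The hypothesis is the orbit relation with its arguments substituted.\<close>

definition Free_orbit :: expr where
  "Free_orbit = (\<^bold>\<Pi>Z : univ 0. \<^bold>\<Pi>z0 : Z. \<^bold>\<Pi>X : univ 0. \<^bold>\<Pi>x0 : X.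
    \<^bold>\<Pi>g : STrunc (pmap Z z0 X x0). \<^bold>\<Pi>h : STrunc (pmap Z z0 X x0).
    PTrunc (\<^bold>\<Sigma>l : pi1 X x0. eq (STrunc (pmap Z z0 X x0)) (act Z z0 X x0 g l) h) \<^bold>\<rightarrow>
    eq (STrunc (Z \<^bold>\<rightarrow> X)) (free_class Z z0 X x0 g) (free_class Z z0 X x0 h))"

lemma Free_orbit: "provable Free_orbit"
  by (rule provable_by[where Hs = "[Orbit_constant, Free_act]" and t = "
    \<^bold>\<lambda>orbitConst freeAct Z z0 X x0 g h.
      orbitConst \<cdot> STrunc (pmap Z z0 X x0) \<cdot> STrunc (Z \<^bold>\<rightarrow> X) \<cdot> str_set (Z \<^bold>\<rightarrow> X)
        \<cdot> (\<^bold>\<lambda>u. free_class Z z0 X x0 u) \<cdot> pi1 X x0 \<cdot> (\<^bold>\<lambda>l. act Z z0 X x0 g l) \<cdot> g \<cdot> h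
        \<cdot> (freeAct \<cdot> Z \<cdot> z0 \<cdot> X \<cdot> x0 \<cdot> g)"])
    (code_simp, simp add: Orbit_constant Free_act)

section \<open>The inverse of forgetting the pointing\<close>

definition preimage_at :: "expr \<Rightarrow> expr \<Rightarrow> expr \<Rightarrow> expr \<Rightarrow> expr \<Rightarrow> expr \<Rightarrow> expr \<Rightarrow> expr" where
  "preimage_at z0 X x0 Q c f k = (\<^bold>\<Sigma>w : eq X (f \<cdot> z0) x0. eq Q k (c \<cdot> f \<cdot> w))"

text \<open>
  The inverse is constructed for any set \<open>Q\<close> with a curried map \<open>c\<close> from the pointed maps to
  \<open>Q\<close>. What the orbit set contributes is that \<open>c\<close> does not see the pointing and that \<open>Q\<close> has induction
  into propositions over the values of \<open>c\<close>.
\<close>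

definition pmap_family :: "expr \<Rightarrow> expr \<Rightarrow> expr \<Rightarrow> expr \<Rightarrow> expr \<Rightarrow> expr" where
  "pmap_family Z z0 X x0 Q = (\<^bold>\<Pi>f : Z \<^bold>\<rightarrow> X. eq X (f \<cdot> z0) x0 \<^bold>\<rightarrow> Q)"

definition basing_invariant :: "expr \<Rightarrow> expr \<Rightarrow> expr \<Rightarrow> expr \<Rightarrow> expr \<Rightarrow> expr \<Rightarrow> expr" where
  "basing_invariant Z z0 X x0 Q c =
    (\<^bold>\<Pi>f : Z \<^bold>\<rightarrow> X. \<^bold>\<Pi>w : eq X (f \<cdot> z0) x0. \<^bold>\<Pi>v : eq X (f \<cdot> z0) x0. eq Q (c \<cdot> f \<cdot> w) (c \<cdot> f \<cdot> v))"

text \<open>The specification of the inverse: \<open>G |f|\<close> is merely of the form \<open>c f w\<close>.\<close>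

definition chooses_class :: "expr \<Rightarrow> expr \<Rightarrow> expr \<Rightarrow> expr \<Rightarrow> expr \<Rightarrow> expr \<Rightarrow> expr \<Rightarrow> expr" where
  "chooses_class Z z0 X x0 Q c G = (\<^bold>\<Pi>f : Z \<^bold>\<rightarrow> X. PTrunc (preimage_at z0 X x0 Q c f (G \<cdot> str (Z \<^bold>\<rightarrow> X) f)))"

text \<open>
  Connectedness gives a mere pointing of each \<open>f\<close>, and \<open>Unique_value\<close> turns it into an element of \<open>Q\<close>;
  the extension to the set truncation needs only that \<open>Q\<close> is a set.
\<close>

definition Class_choice :: expr where
  "Class_choice = (\<^bold>\<Pi>Z : univ 0. \<^bold>\<Pi>z0 : Z. \<^bold>\<Pi>X : univ 0. \<^bold>\<Pi>x0 : X. isConnected X \<^bold>\<rightarrow>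
    (\<^bold>\<Pi>Q : univ 0. isSet Q \<^bold>\<rightarrow> (\<^bold>\<Pi>c : pmap_family Z z0 X x0 Q. basing_invariant Z z0 X x0 Q c \<^bold>\<rightarrow>
      (\<^bold>\<Sigma>G : STrunc (Z \<^bold>\<rightarrow> X) \<^bold>\<rightarrow> Q. chooses_class Z z0 X x0 Q c G))))"

lemma Class_choice: "provable Class_choice"
  by (rule provable_by[where Hs = "[Unique_value]" and t = "
    \<^bold>\<lambda>uniqueValue Z z0 X x0 conn Q set c same.
      (let B = (\<lambda>f k. PTrunc (preimage_at z0 X x0 Q c f k));
           v = (\<lambda>f. uniqueValue \<cdot> Q \<cdot> set \<cdot> eq X (f \<cdot> z0) x0 \<cdot> (c \<cdot> f) \<cdot> (same \<cdot> f)
             \<cdot> (conn \<cdot> (f \<cdot> z0) \<cdot> x0)) in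
       pair (STrunc (Z \<^bold>\<rightarrow> X) \<^bold>\<rightarrow> Q) (chooses_class Z z0 X x0 Q c)
         (\<^bold>\<lambda>y. str_rec (Z \<^bold>\<rightarrow> X) Q set (\<lambda>f. pr1 Q (B f) (v f)) y)
         (\<^bold>\<lambda>f. pr2 Q (B f) (v f)))"])
    (code_simp, simp add: Unique_value)

definition forgets_basing :: "expr \<Rightarrow> expr \<Rightarrow> expr \<Rightarrow> expr \<Rightarrow> expr \<Rightarrow> expr \<Rightarrow> expr" where
  "forgets_basing Z z0 X x0 c F = (\<^bold>\<Pi>f : Z \<^bold>\<rightarrow> X. \<^bold>\<Pi>w : eq X (f \<cdot> z0) x0.
     eq (STrunc (Z \<^bold>\<rightarrow> X)) (F \<cdot> (c \<cdot> f \<cdot> w)) (str (Z \<^bold>\<rightarrow> X) f))"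

text \<open>If \<open>G |f| = c f w\<close>, then \<open>F (G |f|) = F (c f w) = |f|\<close>.\<close>

definition Right_inverse :: expr where
  "Right_inverse = (\<^bold>\<Pi>Z : univ 0. \<^bold>\<Pi>z0 : Z. \<^bold>\<Pi>X : univ 0. \<^bold>\<Pi>x0 : X.
    \<^bold>\<Pi>Q : univ 0. \<^bold>\<Pi>c : pmap_family Z z0 X x0 Q.
    \<^bold>\<Pi>F : Q \<^bold>\<rightarrow> STrunc (Z \<^bold>\<rightarrow> X). forgets_basing Z z0 X x0 c F \<^bold>\<rightarrow>
    (\<^bold>\<Pi>G : STrunc (Z \<^bold>\<rightarrow> X) \<^bold>\<rightarrow> Q. chooses_class Z z0 X x0 Q c G \<^bold>\<rightarrow>
      (\<^bold>\<Pi>y : STrunc (Z \<^bold>\<rightarrow> X). eq (STrunc (Z \<^bold>\<rightarrow> X)) (F \<cdot> (G \<cdot> y)) y)))"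

lemma Right_inverse: "provable Right_inverse"
  by (rule provable_by[where Hs = "[Path_trans, Path_ap, STrunc_prop_ind]" and t = "
    \<^bold>\<lambda>trans ap strInd Z z0 X x0 Q c F induced G choice.
      (let N = STrunc (Z \<^bold>\<rightarrow> X); E = (\<lambda>y. eq N (F \<cdot> (G \<cdot> y)) y);
           set = (\<lambda>y. str_set (Z \<^bold>\<rightarrow> X) \<cdot> (F \<cdot> (G \<cdot> y)) \<cdot> y) in
       strInd \<cdot> (Z \<^bold>\<rightarrow> X) \<cdot> (\<^bold>\<lambda>y. E y) \<cdot> (\<^bold>\<lambda>y. set y)
         \<cdot> (\<^bold>\<lambda>f. let y = str (Z \<^bold>\<rightarrow> X) f in
             ptr_rec (preimage_at z0 X x0 Q c f (G \<cdot> y)) (E y) (set y)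
               (\<lambda>b. sigma_ind (eq X (f \<cdot> z0) x0) (\<lambda>w. eq Q (G \<cdot> y) (c \<cdot> f \<cdot> w)) (\<lambda>_. E y)
                 (\<lambda>w q. trans \<cdot> N \<cdot> (F \<cdot> (G \<cdot> y)) \<cdot> (F \<cdot> (c \<cdot> f \<cdot> w)) \<cdot> y
                   \<cdot> (ap \<cdot> Q \<cdot> N \<cdot> F \<cdot> (G \<cdot> y) \<cdot> (c \<cdot> f \<cdot> w) \<cdot> q)
                   \<cdot> (induced \<cdot> f \<cdot> w)) b) (choice \<cdot> f)))"])
    (code_simp, simp add: Path_trans Path_ap STrunc_prop_ind)

text \<open>
  The map \<open>c\<close> is a function on expressions here, so that an instance at the orbit map contains no redex
  \<open>c \<cdot> f \<cdot> w\<close>: type inference works for an abstraction applied to one argument, but not to two.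
\<close>

definition prop_induction ::
  "expr \<Rightarrow> expr \<Rightarrow> expr \<Rightarrow> expr \<Rightarrow> expr \<Rightarrow> (expr \<Rightarrow> expr \<Rightarrow> expr) \<Rightarrow> expr" where
  "prop_induction Z z0 X x0 Q c = (\<^bold>\<Pi>C : Q \<^bold>\<rightarrow> univ 0. (\<^bold>\<Pi>k : Q. isProp (C \<cdot> k)) \<^bold>\<rightarrow>
     (\<^bold>\<Pi>f : Z \<^bold>\<rightarrow> X. \<^bold>\<Pi>w : eq X (f \<cdot> z0) x0. C \<cdot> c f w) \<^bold>\<rightarrow> (\<^bold>\<Pi>k : Q. C \<cdot> k))"

text \<open>
  On a value of \<open>c\<close>, with \<open>G |f| = c f v\<close>: \<open>G (F (c f w)) = G |f| = c f v = c f w\<close>.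
\<close>

definition Left_inverse :: expr where
  "Left_inverse = (\<^bold>\<Pi>Z : univ 0. \<^bold>\<Pi>z0 : Z. \<^bold>\<Pi>X : univ 0. \<^bold>\<Pi>x0 : X.
    \<^bold>\<Pi>Q : univ 0. isSet Q \<^bold>\<rightarrow> (\<^bold>\<Pi>c : pmap_family Z z0 X x0 Q.
    basing_invariant Z z0 X x0 Q c \<^bold>\<rightarrow> prop_induction Z z0 X x0 Q (\<lambda>f w. c \<cdot> f \<cdot> w) \<^bold>\<rightarrow>
    (\<^bold>\<Pi>F : Q \<^bold>\<rightarrow> STrunc (Z \<^bold>\<rightarrow> X). forgets_basing Z z0 X x0 c F \<^bold>\<rightarrow>
    (\<^bold>\<Pi>G : STrunc (Z \<^bold>\<rightarrow> X) \<^bold>\<rightarrow> Q. chooses_class Z z0 X x0 Q c G \<^bold>\<rightarrow>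
      (\<^bold>\<Pi>k : Q. eq Q (G \<cdot> (F \<cdot> k)) k)))))"

lemma Left_inverse: "provable Left_inverse"
  by (rule provable_by[where Hs = "[Path_trans, Path_ap]" and t = "
    \<^bold>\<lambda>trans ap Z z0 X x0 Q set c same ind F induced G choice.
      (let N = STrunc (Z \<^bold>\<rightarrow> X); E = (\<lambda>k. eq Q (G \<cdot> (F \<cdot> k)) k);
           prop = (\<lambda>k. set \<cdot> (G \<cdot> (F \<cdot> k)) \<cdot> k) in
       ind \<cdot> (\<^bold>\<lambda>k. E k) \<cdot> (\<^bold>\<lambda>k. prop k)
         \<cdot> (\<^bold>\<lambda>f w. let y = str (Z \<^bold>\<rightarrow> X) f; k = c \<cdot> f \<cdot> w in
             ptr_rec (preimage_at z0 X x0 Q c f (G \<cdot> y)) (E k) (prop k)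
               (\<lambda>b. sigma_ind (eq X (f \<cdot> z0) x0) (\<lambda>v. eq Q (G \<cdot> y) (c \<cdot> f \<cdot> v)) (\<lambda>_. E k)
                 (\<lambda>v q. trans \<cdot> Q \<cdot> (G \<cdot> (F \<cdot> k)) \<cdot> (G \<cdot> y) \<cdot> k
                   \<cdot> (ap \<cdot> N \<cdot> Q \<cdot> G \<cdot> (F \<cdot> k) \<cdot> y \<cdot> (induced \<cdot> f \<cdot> w))
                   \<cdot> (trans \<cdot> Q \<cdot> (G \<cdot> y) \<cdot> (c \<cdot> f \<cdot> v) \<cdot> k \<cdot> q \<cdot> (same \<cdot> f \<cdot> v \<cdot> w))) b)
               (choice \<cdot> f)))"])
    (code_simp, simp add: Path_trans Path_ap)

text \<open>The inverse \<open>G\<close> serves as left and as right inverse.\<close>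

definition Classifying_equiv :: expr where
  "Classifying_equiv = (\<^bold>\<Pi>Z : univ 0. \<^bold>\<Pi>z0 : Z. \<^bold>\<Pi>X : univ 0. \<^bold>\<Pi>x0 : X. isConnected X \<^bold>\<rightarrow>
    (\<^bold>\<Pi>Q : univ 0. isSet Q \<^bold>\<rightarrow> (\<^bold>\<Pi>c : pmap_family Z z0 X x0 Q.
    basing_invariant Z z0 X x0 Q c \<^bold>\<rightarrow> prop_induction Z z0 X x0 Q (\<lambda>f w. c \<cdot> f \<cdot> w) \<^bold>\<rightarrow>
    (\<^bold>\<Pi>F : Q \<^bold>\<rightarrow> STrunc (Z \<^bold>\<rightarrow> X). forgets_basing Z z0 X x0 c F \<^bold>\<rightarrow> isEquiv Q (STrunc (Z \<^bold>\<rightarrow> X)) F))))"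

lemma Classifying_equiv: "provable Classifying_equiv"
  by (rule provable_by[where Hs = "[Class_choice, Right_inverse, Left_inverse]" and t = "
    \<^bold>\<lambda>classChoice rightInverse leftInverse Z z0 X x0 conn Q set c same ind F induced.
      (let N = STrunc (Z \<^bold>\<rightarrow> X); bas = chooses_class Z z0 X x0 Q c in
         sigma_ind (N \<^bold>\<rightarrow> Q) bas (\<lambda>_. isEquiv Q N F)
           (\<lambda>G b. pair (rinv Q N F) (\<lambda>_. linv Q N F)
                 (pair (N \<^bold>\<rightarrow> Q) (\<lambda>g. \<^bold>\<Pi>b : N. eq N (F \<cdot> (g \<cdot> b)) b) G
                   (rightInverse \<cdot> Z \<cdot> z0 \<cdot> X \<cdot> x0 \<cdot> Q \<cdot> c \<cdot> F \<cdot> induced \<cdot> G \<cdot> b))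
                 (pair (N \<^bold>\<rightarrow> Q) (\<lambda>h. \<^bold>\<Pi>a : Q. eq Q (h \<cdot> (F \<cdot> a)) a) G
                   (leftInverse \<cdot> Z \<cdot> z0 \<cdot> X \<cdot> x0 \<cdot> Q \<cdot> set \<cdot> c \<cdot> same \<cdot> ind \<cdot> F \<cdot> induced \<cdot> G \<cdot> b)))
           (classChoice \<cdot> Z \<cdot> z0 \<cdot> X \<cdot> x0 \<cdot> conn \<cdot> Q \<cdot> set \<cdot> c \<cdot> same))"])
    (code_simp, simp add: Class_choice Right_inverse Left_inverse)

section \<open>The theorem\<close>

text \<open>An arbitrary relation in place of the orbit relation keeps the types to be checked small.\<close>

definition Orbit_prop_ind :: expr where
  "Orbit_prop_ind = (\<^bold>\<Pi>Z : univ 0. \<^bold>\<Pi>z0 : Z. \<^bold>\<Pi>X : univ 0. \<^bold>\<Pi>x0 : X.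
    \<^bold>\<Pi>R : (STrunc (pmap Z z0 X x0) \<^bold>\<rightarrow> STrunc (pmap Z z0 X x0) \<^bold>\<rightarrow> univ 0).
    prop_induction Z z0 X x0 (cst CQuot [STrunc (pmap Z z0 X x0), R])
      (\<lambda>f w. cst CCls [STrunc (pmap Z z0 X x0), R, based Z z0 X x0 f w]))"

lemma Orbit_prop_ind: "provable Orbit_prop_ind"
  by (rule provable_by[where Hs = "[STrunc_prop_ind, Quot_prop_ind]" and t = "
    \<^bold>\<lambda>strInd quotInd Z z0 X x0 R C h d.
      (let M = STrunc (pmap Z z0 X x0); c = (\<lambda>g. cst CCls [M, R, g]) in
       quotInd \<cdot> M \<cdot> R \<cdot> C \<cdot> h
         \<cdot> (strInd \<cdot> pmap Z z0 X x0 \<cdot> (\<^bold>\<lambda>g. C \<cdot> c g) \<cdot> (\<^bold>\<lambda>g. h \<cdot> c g)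
             \<cdot> (\<^bold>\<lambda>g. sigma_ind (Z \<^bold>\<rightarrow> X) (\<lambda>f. eq X (f \<cdot> z0) x0)
                 (\<lambda>g. C \<cdot> c (str (pmap Z z0 X x0) g)) (\<lambda>f w. d \<cdot> f \<cdot> w) g)))"])
    (code_simp, simp add: STrunc_prop_ind Quot_prop_ind)

text \<open>
  On the orbit of \<open>|g|\<close>, \<open>Quot_rec\<close> gives \<open>free_class\<close> at \<open>|g|\<close>, which computes to the class of the
  underlying map of \<open>g\<close>.
\<close>

definition Orbit_map :: expr where
  "Orbit_map = (\<^bold>\<Pi>Z : univ 0. \<^bold>\<Pi>z0 : Z. \<^bold>\<Pi>X : univ 0. \<^bold>\<Pi>x0 : X.
    (\<^bold>\<Sigma>F : Orbits Z z0 X x0 \<^bold>\<rightarrow> STrunc (Z \<^bold>\<rightarrow> X). isInduced Z z0 X x0 F))"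

lemma Orbit_map: "provable Orbit_map"
  by (rule provable_by[where Hs = "[Quot_rec, Free_orbit]" and t = "
    \<^bold>\<lambda>quotRec freeOrbit Z z0 X x0.
      quotRec \<cdot> STrunc (pmap Z z0 X x0) \<cdot> orbitRel Z z0 X x0 \<cdot> STrunc (Z \<^bold>\<rightarrow> X) \<cdot> str_set (Z \<^bold>\<rightarrow> X)
        \<cdot> (\<^bold>\<lambda>u. free_class Z z0 X x0 u) \<cdot> (freeOrbit \<cdot> Z \<cdot> z0 \<cdot> X \<cdot> x0)
        \<cdot> pmap Z z0 X x0 \<cdot> (\<^bold>\<lambda>g. str (pmap Z z0 X x0) g)"])
    (code_simp, simp add: Quot_rec Free_orbit)

definition Orbit_map_equiv :: expr where
  "Orbit_map_equiv = (\<^bold>\<Pi>Z : univ 0. \<^bold>\<Pi>z0 : Z. \<^bold>\<Pi>X : univ 0. \<^bold>\<Pi>x0 : X. isConnected X \<^bold>\<rightarrow>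
    (\<^bold>\<Pi>F : Orbits Z z0 X x0 \<^bold>\<rightarrow> STrunc (Z \<^bold>\<rightarrow> X). isInduced Z z0 X x0 F \<^bold>\<rightarrow>
      isEquiv (Orbits Z z0 X x0) (STrunc (Z \<^bold>\<rightarrow> X)) F))"

lemma Orbit_map_equiv: "provable Orbit_map_equiv"
  by (rule provable_by[where Hs = "[Classifying_equiv, Orbit_basing_invariant, Orbit_prop_ind]" and t = "
    \<^bold>\<lambda>classifyingEquiv sameOrbit orbitInd Z z0 X x0 conn F induced.
      (let M = STrunc (pmap Z z0 X x0); R = orbitRel Z z0 X x0 in
       classifyingEquiv \<cdot> Z \<cdot> z0 \<cdot> X \<cdot> x0 \<cdot> conn \<cdot> Orbits Z z0 X x0 \<cdot> cst CQuotSet [M, R]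
         \<cdot> (\<^bold>\<lambda>f w. point_orbit Z z0 X x0 f w) \<cdot> (sameOrbit \<cdot> Z \<cdot> z0 \<cdot> X \<cdot> x0)
         \<cdot> (orbitInd \<cdot> Z \<cdot> z0 \<cdot> X \<cdot> x0 \<cdot> R) \<cdot> F
         \<cdot> (\<^bold>\<lambda>f w. induced \<cdot> pair (Z \<^bold>\<rightarrow> X) (\<lambda>f. eq X (f \<cdot> z0) x0) f w))"])
    (code_simp, simp add: Classifying_equiv Orbit_basing_invariant Orbit_prop_ind)

definition Orbit_theorem :: "nat \<Rightarrow> expr" where
  "Orbit_theorem i = (\<^bold>\<Pi>Z : univ i. \<^bold>\<Pi>z0 : Z. \<^bold>\<Pi>X : univ i. \<^bold>\<Pi>x0 : X. isConnected X \<^bold>\<rightarrow>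
      (\<^bold>\<Sigma>F : Orbits Z z0 X x0 \<^bold>\<rightarrow> STrunc (Z \<^bold>\<rightarrow> X).
        isInduced Z z0 X x0 F \<^bold>\<times> isEquiv (Orbits Z z0 X x0) (STrunc (Z \<^bold>\<rightarrow> X)) F))"

lemma Orbit_theorem: "provable (Orbit_theorem 0)"
  by (rule provable_by[where Hs = "[Sigma_refine, Orbit_map, Orbit_map_equiv]" and t = "
    \<^bold>\<lambda>sigmaRefine orbitMap orbitMapEquiv Z z0 X x0 conn.
      (let N = STrunc (Z \<^bold>\<rightarrow> X); Q = Orbits Z z0 X x0 in
       sigmaRefine \<cdot> (Q \<^bold>\<rightarrow> N) \<cdot> (\<^bold>\<lambda>F. isInduced Z z0 X x0 F) \<cdot> (\<^bold>\<lambda>F. isEquiv Q N F)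
         \<cdot> (orbitMap \<cdot> Z \<cdot> z0 \<cdot> X \<cdot> x0) \<cdot> (orbitMapEquiv \<cdot> Z \<cdot> z0 \<cdot> X \<cdot> x0 \<cdot> conn))"])
    (code_simp, simp add: Sigma_refine Orbit_map Orbit_map_equiv)

lemma raise_Orbit_theorem: "raise i (closed (Orbit_theorem 0)) = closed (Orbit_theorem i)"
  by (simp add: Orbit_theorem_def hott_defs isConnected_def Orbits_def STrunc_def PTrunc_def isInduced_def
      pmap_def orbitRel_def act_def orbit_def str_def forget_def pi1_def)

theorem lemma20:
  fixes i :: nat
  shows "provable
    (\<^bold>\<Pi>Z : univ i. \<^bold>\<Pi>z0 : Z. \<^bold>\<Pi>X : univ i. \<^bold>\<Pi>x0 : X. isConnected X \<^bold>\<rightarrow>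
      (\<^bold>\<Sigma>F : Orbits Z z0 X x0 \<^bold>\<rightarrow> STrunc (Z \<^bold>\<rightarrow> X).
        isInduced Z z0 X x0 F \<^bold>\<times> isEquiv (Orbits Z z0 X x0) (STrunc (Z \<^bold>\<rightarrow> X)) F))"
proof -
  from Orbit_theorem obtain j t where "[] \<turnstile> closed (Orbit_theorem 0) : U j" "[] \<turnstile> t : closed (Orbit_theorem 0)"
    by (auto simp: provable_def)
  then have "[] \<turnstile> raise i (closed (Orbit_theorem 0)) : U (j + i)"
    "[] \<turnstile> raise i t : raise i (closed (Orbit_theorem 0))"
    using typing_raise[where k = i and \<Gamma> = "[]" and A = "U j"]
      typing_raise[where k = i and \<Gamma> = "[]" and A = "closed (Orbit_theorem 0)"] by simp_all
  then show ?thesis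
    unfolding Orbit_theorem_def[symmetric] provable_def raise_Orbit_theorem by blast
qed

end
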